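(* For fixed $\rho,\sigma\in\{0,1\}$ and for the parameters $a_{12}=\lambda$, $b_{12}=\frac{c(\lambda+\mu+\gamma)}{1-c}$, $r_{12}=\frac{\lambda+c\mu+c^2\gamma}{c-1}$, let $d_k$ and $\tilde d_k$ for $k=0,1,2,\ldots$ be the vectors defined by the recurrence relations \begin{align*} u_k & := \big(A+\tfrac{\rho}{2}-k\big)^{-1}\left(\big(B-\tfrac{\sigma}{2}+\tfrac{1}{2}\big)d_{k-1} + \tfrac{1}{c}Su_{k-1} + \tfrac{1}{c}Rs_{k-1}\right),\\ d_k & := d_{k-1}+u_k,\quad s_k := \tfrac{1}{c}s_{k-1}+u_k\quad (k\geq 1),\qquad u_0=s_0=d_0:=a_0, \end{align*} and \begin{align*} \tilde u_k & := \big(B+\tfrac{\sigma}{2}-k\big)^{-1}\left(\big(A+\tfrac{\rho}{2}+1\big)\tilde d_{k-1} - \tfrac{1}{c}S\tilde u_{k-1} + \tfrac{1}{1-c}R\tilde s_{k-1}\right),\\ \tilde d_k & := \tilde d_{k-1}+\tilde u_k,\quad\tilde s_k := \tfrac{1}{1-c}\tilde s_{k-1}+\tilde u_k\quad (k\geq 1),\qquad \tilde u_0=\tilde s_0=\tilde d_0:=b_2, \end{align*} respectively. Moreover, for an arbitrary $n\geq 0$, let \begin{equation*} p_k := b_2 + \sum_{\ell=1}^n \left(\prod_{m=0}^{\ell-1}\frac{m+\frac{1}{2}-\sigma}{m+\frac{1}{2}-\sigma-k}\right)\tilde d_\ell,\quad \vartheta_k := \frac{1}{b_1^{\operatorname{T}}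 Jp_k}Jp_k,\quad J := \begin{pmatrix} 0 & 1 \\[1ex] -1 & 0 \end{pmatrix} \end{equation*} where $b_1^{\operatorname{T}} Jp_k\neq 0$ for sufficiently large $k$, say for $k\geq k_1$. If we define $\Theta_k := d_k^{\operatorname{T}}\vartheta_k$ for all $k\geq k_1$, then $\lim_{k\to\infty}\Theta_k = \Theta$, and the convergence being $\mathcal{O}(k^{\sigma-n-3/2})$.
   Context: Let $c>1$ and $\gamma,\lambda,\mu\in\mathbb{C}$. Consider the $2\times 2$ system associated with the ellipsoidal wave equation $z(z-1)(z-c)w''+\tfrac12(3z^2-2(1+c)z+c)w'+(\lambda+\mu z+\gamma z^2)w=0$ (via $y=(-cw',w)^{\operatorname{T}}$): $y'(z)=\left(\frac1z A+\frac{1}{z-1}B+\frac{1}{z-c}R-\frac1c S\right)y(z)$, with $A=\begin{pmatrix}-\frac12 & a_{12}\\ 0&0\end{pmatrix}$, $B=\begin{pmatrix}-\frac12 & b_{12}\\ 0&0\end{pmatrix}$, $R=\begin{pmatrix}-\frac12 & r_{12}\\ 0&0\end{pmatrix}$, $S=\begin{pmatrix}0&0\\1&0\end{pmatrix}$, where $a_{12}=\lambda$, $b_{12}=\frac{c(\lambda+\mu+\gamma)}{1-c}$, $r_{12}=\frac{\lambda+c\mu+c^2\gamma}{c-1}$. For $\rho,\sigma\in\{0,1\}$, let $\alpha_0=-\rho/2$ (eigenvalue of $A$), $\beta_1=(\sigma-1)/2$, $\beta_2=-\sigma/2$ (eigenvalues of $B$), with eigenvectors $a_0=\begin{pmatrix}2a_{12}(1-\rho)+\frac\rho2\\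 1-\rho\end{pmatrix}$, $b_1=\begin{pmatrix}2b_{12}\sigma+\frac{1-\sigma}{2}\\ \sigma\end{pmatrix}$, $b_2=\begin{pmatrix}2b_{12}(1-\sigma)+\frac\sigma2\\ 1-\sigma\end{pmatrix}$; $\delta=\beta_2-\beta_1=\tfrac12-\sigma$. The system has a Floquet solution $y_0(z)=z^{\alpha_0}h_0(z)$ near $0$ with $h_0$ holomorphic, $h_0(0)=a_0$, and near $z=1$ a fundamental matrix $Y(z)=H(z)\operatorname{diag}\big((1-z)^{\beta_1},(1-z)^{\beta_2}\big)\begin{pmatrix}1&0\\ q\log(1-z)&1\end{pmatrix}$ with $H$ holomorphic, $H(1)e_1=b_1$, $H(1)e_2=b_2$ ($q=0$ if $\delta\notin\mathbb{Z}$). The connection coefficients $\Theta,\Omega$ are defined by $y_0(z)=Y(z)\begin{pmatrix}\Theta\\ \Omega\end{pmatrix}$ on the common domain (i.e. $y_0=\Theta y_1+\Omega y_2$ with $y_j=Ye_j$). *)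

theory Defs
  imports "HOL-Analysis.Analysis" "HOL-Library.Landau_Symbols"
begin

definition vec2 :: "complex \<Rightarrow> complex \<Rightarrow> complex^2" where
  "vec2 a b = (\<chi> i. if i = 1 then a else b)"

definition mat2 :: "complex \<Rightarrow> complex \<Rightarrow> complex \<Rightarrow> complex \<Rightarrow> complex^2^2" where
  "mat2 a b c d = (\<chi> i j. if i = 1 then (if j = 1 then a else b) else (if j = 1 then c else d))"

definition msc :: "complex \<Rightarrow> complex^2^2 \<Rightarrow> complex^2^2" where
  "msc x M = (\<chi> i j. x * M $ i $ j)"

definition bil :: "complex^2 \<Rightarrow> complex^2 \<Rightarrow> complex" where
  "bil x y = x $ 1 * y $ 1 + x $ 2 * y $ 2"

definition a12 :: "complex \<Rightarrow> complex \<Rightarrow> complex \<Rightarrow> real \<Rightarrow> complex" where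
  "a12 lam mu gam c = lam"
definition b12 :: "complex \<Rightarrow> complex \<Rightarrow> complex \<Rightarrow> real \<Rightarrow> complex" where
  "b12 lam mu gam c = of_real c * (lam + mu + gam) / (1 - of_real c)"
definition r12 :: "complex \<Rightarrow> complex \<Rightarrow> complex \<Rightarrow> real \<Rightarrow> complex" where
  "r12 lam mu gam c = (lam + of_real c * mu + (of_real c)^2 * gam) / (of_real c - 1)"

definition matA where "matA lam mu gam c = mat2 (-1/2) (a12 lam mu gam c) 0 0"
definition matB where "matB lam mu gam c = mat2 (-1/2) (b12 lam mu gam c) 0 0"
definition matR where "matR lam mu gam c = mat2 (-1/2) (r12 lam mu gam c) 0 0"
definition matS :: "complex^2^2" where "matS = mat2 0 0 1 0"
definition matJ :: "complex^2^2" where "matJ = mat2 0 1 (-1) 0"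

definition coeffM :: "complex \<Rightarrow> complex \<Rightarrow> complex \<Rightarrow> real \<Rightarrow> complex \<Rightarrow> complex^2^2" where
  "coeffM lam mu gam c z =
     msc (1/z) (matA lam mu gam c) + msc (1/(z-1)) (matB lam mu gam c)
     + msc (1/(z - of_real c)) (matR lam mu gam c) - msc (1/of_real c) matS"

(* eigenvectors *)
definition vec_a0 :: "complex \<Rightarrow> complex \<Rightarrow> complex \<Rightarrow> real \<Rightarrow> nat \<Rightarrow> complex^2" where
  "vec_a0 lam mu gam c \<rho> = vec2 (2 * a12 lam mu gam c * (1 - of_nat \<rho>) + of_nat \<rho> / 2) (1 - of_nat \<rho>)"
definition vec_b1 :: "complex \<Rightarrow> complex \<Rightarrow> complex \<Rightarrow> real \<Rightarrow> nat \<Rightarrow> complex^2" where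
  "vec_b1 lam mu gam c \<sigma> = vec2 (2 * b12 lam mu gam c * of_nat \<sigma> + (1 - of_nat \<sigma>) / 2) (of_nat \<sigma>)"
definition vec_b2 :: "complex \<Rightarrow> complex \<Rightarrow> complex \<Rightarrow> real \<Rightarrow> nat \<Rightarrow> complex^2" where
  "vec_b2 lam mu gam c \<sigma> = vec2 (2 * b12 lam mu gam c * (1 - of_nat \<sigma>) + of_nat \<sigma> / 2) (1 - of_nat \<sigma>)"

fun usd :: "complex \<Rightarrow> complex \<Rightarrow> complex \<Rightarrow> real \<Rightarrow> nat \<Rightarrow> nat \<Rightarrow> nat \<Rightarrow> (complex^2) \<times> (complex^2) \<times> (complex^2)" where
  "usd lam mu gam c \<rho> \<sigma> 0 = (let a = vec_a0 lam mu gam c \<rho> in (a, a, a))"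
| "usd lam mu gam c \<rho> \<sigma> (Suc k) =
     (let (u', s', d') = usd lam mu gam c \<rho> \<sigma> k;
          cc = (of_real c :: complex);
          u = matrix_inv (matA lam mu gam c + mat (of_nat \<rho> / 2 - of_nat (Suc k)))
              *v ((matB lam mu gam c + mat (1/2 - of_nat \<sigma> / 2)) *v d'
                  + (1/cc) *s (matS *v u') + (1/cc) *s (matR lam mu gam c *v s'))
      in (u, (1/cc) *s s' + u, d' + u))"

definition dseq where "dseq lam mu gam c \<rho> \<sigma> k = snd (snd (usd lam mu gam c \<rho> \<sigma> k))"

fun usd_t :: "complex \<Rightarrow> complex \<Rightarrow> complex \<Rightarrow> real \<Rightarrow> nat \<Rightarrow> nat \<Rightarrow> nat \<Rightarrow> (complex^2) \<times> (complex^2) \<times> (complex^2)" where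
  "usd_t lam mu gam c \<rho> \<sigma> 0 = (let b = vec_b2 lam mu gam c \<sigma> in (b, b, b))"
| "usd_t lam mu gam c \<rho> \<sigma> (Suc k) =
     (let (u', s', d') = usd_t lam mu gam c \<rho> \<sigma> k;
          cc = (of_real c :: complex);
          u = matrix_inv (matB lam mu gam c + mat (of_nat \<sigma> / 2 - of_nat (Suc k)))
              *v ((matA lam mu gam c + mat (of_nat \<rho> / 2 + 1)) *v d'
                  - (1/cc) *s (matS *v u') + (1/(1 - cc)) *s (matR lam mu gam c *v s'))
      in (u, (1/(1 - cc)) *s s' + u, d' + u))"

definition dseq_t where "dseq_t lam mu gam c \<rho> \<sigma> k = snd (snd (usd_t lam mu gam c \<rho> \<sigma> k))"

definition pvec :: "complex \<Rightarrow> complex \<Rightarrow> complex \<Rightarrow> real \<Rightarrow> nat \<Rightarrow> nat \<Rightarrow> nat \<Rightarrow> nat \<Rightarrow> complex^2" where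
  "pvec lam mu gam c \<rho> \<sigma> n k = vec_b2 lam mu gam c \<sigma> +
     (\<Sum>l=1..n. (\<Prod>m=0..<l. (of_nat m + 1/2 - of_nat \<sigma>) / (of_nat m + 1/2 - of_nat \<sigma> - of_nat k))
                  *s dseq_t lam mu gam c \<rho> \<sigma> l)"

definition varth :: "complex \<Rightarrow> complex \<Rightarrow> complex \<Rightarrow> real \<Rightarrow> nat \<Rightarrow> nat \<Rightarrow> nat \<Rightarrow> nat \<Rightarrow> complex^2" where
  "varth lam mu gam c \<rho> \<sigma> n k =
     (1 / bil (vec_b1 lam mu gam c \<sigma>) (matJ *v pvec lam mu gam c \<rho> \<sigma> n k))
       *s (matJ *v pvec lam mu gam c \<rho> \<sigma> n k)"

definition Theta_k :: "complex \<Rightarrow> complex \<Rightarrow> complex \<Rightarrow> real \<Rightarrow> nat \<Rightarrow> nat \<Rightarrow> nat \<Rightarrow> nat \<Rightarrow> complex" where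
  "Theta_k lam mu gam c \<rho> \<sigma> n k = bil (dseq lam mu gam c \<rho> \<sigma> k) (varth lam mu gam c \<rho> \<sigma> n k)"

definition solves_on :: "complex \<Rightarrow> complex \<Rightarrow> complex \<Rightarrow> real \<Rightarrow> (complex \<Rightarrow> complex^2) \<Rightarrow> complex set \<Rightarrow> bool" where
  "solves_on lam mu gam c y U \<longleftrightarrow>
     (\<forall>z\<in>U. \<forall>i. ((\<lambda>w. y w $ i) has_field_derivative ((coeffM lam mu gam c z *v y z) $ i)) (at z))"

end

theory Submission
  imports Defs "HOL-Complex_Analysis.Complex_Analysis"
begin

text \<open>
  The \<open>d\<^sub>k\<close> are the Taylor coefficients at \<open>0\<close> of \<open>f(z) = (1 - z)\<^bsup>-\<beta>\<^sub>1-1\<^esup> h\<^sub>0(z)\<close>, and the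
  \<open>d\<close>-tilde are the Taylor coefficients in \<open>1 - z\<close> of \<open>z\<^bsup>-\<alpha>\<^sub>0\<^esup> H(z) e\<^sub>2\<close>: both recurrences are the
  differential system, read off coefficientwise.  By the connection relation, near \<open>1\<close>
  \<open>f(z) = \<Theta> (1 - z)\<^sup>-\<^sup>1 z\<^bsup>-\<alpha>\<^sub>0\<^esup> H(z) e\<^sub>1 + \<Omega> (1 - z)\<^bsup>\<delta>-1\<^esup> z\<^bsup>-\<alpha>\<^sub>0\<^esup> H(z) e\<^sub>2\<close>.  Subtracting from \<open>f\<close> the
  leading singular terms at \<open>1\<close> leaves a function whose derivatives of a prescribed order are
  bounded on the unit disc; away from \<open>1\<close> this follows from the differential system and Gronwall's
  inequality along rays.  Hence (Darboux)
  \<open>d\<^sub>k = \<Theta> b\<^sub>1 + \<Omega> w\<^sub>k p\<^sub>k + O(k\<^bsup>-\<delta>-n-1\<^esup>)\<close> with \<open>w\<^sub>k\<close> the \<open>k\<close>-th coefficient of \<open>(1 - z)\<^bsup>\<delta>-1\<^esup>\<close>: the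
  products in \<open>p\<^sub>k\<close> are the quotients of the \<open>k\<close>-th coefficients of \<open>(1 - z)\<^bsup>\<delta>-1+l\<^esup>\<close> and
  \<open>(1 - z)\<^bsup>\<delta>-1\<^esup>\<close>.  Pairing with \<open>J p\<^sub>k\<close> kills the \<open>\<Omega>\<close>-term, as \<open>J\<close> is alternating.
\<close>

no_notation fps_nth (infixl "$" 75)

section \<open>Taylor coefficients of Floquet solutions\<close>

text \<open>Defined by iterated derivatives because the decay estimates act on derivatives; sums and
  products are handled through \<open>has_fps_expansion\<close>.\<close>

definition taylor_coeff :: "(complex \<Rightarrow> complex) \<Rightarrow> nat \<Rightarrow> complex" where
  "taylor_coeff f k = (deriv ^^ k) f 0 / fact k"

lemma taylor_coeff_eqI: "f has_fps_expansion F \<Longrightarrow> taylor_coeff f k = fps_nth F k"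
  by (simp add: taylor_coeff_def fps_nth_fps_expansion)

lemma has_fps_expansion_taylor_coeff:
  assumes "f holomorphic_on ball 0 r" "r > 0"
  shows "f has_fps_expansion Abs_fps (taylor_coeff f)"
proof -
  have "f has_fps_expansion fps_expansion f 0"
    using assms by (intro has_fps_expansion_fps_expansion[of "ball 0 r"]) auto
  then show ?thesis
    by (simp add: fps_expansion_def taylor_coeff_def[abs_def])
qed

lemma taylor_coeff_cong:
  assumes "\<And>z. z \<in> ball 0 r \<Longrightarrow> f z = g z" "r > 0"
  shows "taylor_coeff f k = taylor_coeff g k"
proof -
  have "eventually (\<lambda>z. z \<in> ball 0 r) (nhds (0::complex))"
    using assms(2) by (intro eventually_nhds_in_open) auto
  then have "eventually (\<lambda>z. f z = g z) (nhds 0)"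
    by eventually_elim (use assms in auto)
  then show ?thesis
    unfolding taylor_coeff_def by (simp add: higher_deriv_cong_ev[OF _ refl])
qed

text \<open>A nonpositive real \<open>1 - z\<close> makes \<open>z\<close> real and at least 1,
  which the closed disc permits only at 1. Including the boundary circle is what allows powers of
  \<open>1 - z\<close> to be bounded by compactness.\<close>

lemma one_minus_notin_nonpos_Reals:
  fixes z :: complex
  assumes "norm z \<le> 1" "z \<noteq> 1"
  shows "1 - z \<notin> \<real>\<^sub>\<le>\<^sub>0"
proof
  assume "1 - z \<in> \<real>\<^sub>\<le>\<^sub>0"
  then have "Re z \<ge> 1" "Im z = 0" by (auto simp: complex_nonpos_Reals_iff)
  then have "z = 1" using assms(1) complex_Re_le_cmod[of z] by (auto simp: complex_eq_iff)
  then show False using assms(2) by simp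
qed

lemma holomorphic_on_reflect:
  fixes F :: "complex \<Rightarrow> complex"
  assumes "F holomorphic_on ball (1 - a) r"
  shows "(\<lambda>x. F (1 - x)) holomorphic_on ball a r"
proof -
  have "F \<circ> (\<lambda>x. 1 - x) holomorphic_on ball a r"
  proof (rule holomorphic_on_compose_gen[OF _ assms])
    show "(\<lambda>x. 1 - x) ` ball a r \<subseteq> ball (1 - a) r"
      by (auto simp: dist_norm norm_minus_commute)
  qed (auto intro!: holomorphic_intros)
  then show ?thesis by (simp add: o_def)
qed

lemma holomorphic_on_one_minus_powr:
  assumes "r \<le> 1"
  shows "(\<lambda>z. (1 - z) powr e) holomorphic_on ball 0 r"
proof (intro holomorphic_intros)
  show "1 - z \<notin> \<real>\<^sub>\<le>\<^sub>0" if "z \<in> ball 0 r" for z :: complex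
    by (rule one_minus_notin_nonpos_Reals) (use that assms in auto)
qed

lemma has_field_derivative_one_minus_powr:
  fixes z e :: complex
  assumes "z \<in> ball 0 1"
  shows "((\<lambda>z. (1 - z) powr e) has_field_derivative - e * (1 - z) powr (e - 1)) (at z)"
proof -
  have "1 - z \<notin> \<real>\<^sub>\<le>\<^sub>0"
    by (rule one_minus_notin_nonpos_Reals) (use assms in auto)
  then have "((\<lambda>w. w powr e) has_field_derivative e * (1 - z) powr (e - 1)) (at (1 - z))"
    by (rule has_field_derivative_powr)
  moreover have "((\<lambda>z. 1 - z) has_field_derivative - 1) (at z)"
    by (auto intro!: derivative_eq_intros)
  ultimately show ?thesis
    by (rule DERIV_cong[OF DERIV_chain2]) simp
qed

text \<open>The system with residue matrices of the shape of \<open>A\<close>, \<open>B\<close>, \<open>R\<close> at \<open>0\<close>, \<open>1\<close>, \<open>\<kappa>\<close> and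
  constant term \<open>- s S\<close>.  The substitution \<open>z \<mapsto> 1 - z\<close> exchanges \<open>A\<close> and \<open>B\<close> and maps \<open>(\<kappa>, s)\<close>
  to \<open>(1 - \<kappa>, - s)\<close>, so that the expansions at \<open>0\<close> and at \<open>1\<close> are instances of the same lemmas.\<close>

definition floquet_sys ::
    "complex \<Rightarrow> complex \<Rightarrow> complex \<Rightarrow> complex \<Rightarrow> complex \<Rightarrow> complex \<Rightarrow>
     (complex \<Rightarrow> complex) \<Rightarrow> (complex \<Rightarrow> complex) \<Rightarrow> complex set \<Rightarrow> bool" where
  "floquet_sys a b r \<kappa> s \<alpha> h1 h2 U \<longleftrightarrow>
     (\<forall>z\<in>U. z * deriv h1 z = (- 1/2 - \<alpha>) * h1 z + a * h2 z
               + z / (z - 1) * (- 1/2 * h1 z + b * h2 z)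
               + z / (z - \<kappa>) * (- 1/2 * h1 z + r * h2 z) \<and>
            z * deriv h2 z = - \<alpha> * h2 z - s * z * h1 z)"

text \<open>The product rule cancels the factor \<open>z powr \<alpha>\<close> on half of the slit
  disc. Multiplied by \<open>z\<close>, the remaining equations have both sides holomorphic on the
  whole disc, so the identity theorem carries them across the cut and the origin.\<close>

lemma floquet_sysI:
  fixes h1 h2 :: "complex \<Rightarrow> complex"
  assumes hol: "h1 holomorphic_on ball 0 \<epsilon>" "h2 holomorphic_on ball 0 \<epsilon>"
    and eps: "0 < \<epsilon>" "\<epsilon> \<le> 1" "\<epsilon> \<le> norm \<kappa>"
    and sol1: "\<And>z. z \<in> ball 0 \<epsilon> - {z. Im z = 0 \<and> Re z \<le> 0} \<Longrightarrow>
       ((\<lambda>w. w powr \<alpha> * h1 w) has_field_derivative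
          z powr \<alpha> * ((1/z) * (- 1/2 * h1 z + a * h2 z) + (1/(z - 1)) * (- 1/2 * h1 z + b * h2 z)
                      + (1/(z - \<kappa>)) * (- 1/2 * h1 z + r * h2 z))) (at z)"
    and sol2: "\<And>z. z \<in> ball 0 \<epsilon> - {z. Im z = 0 \<and> Re z \<le> 0} \<Longrightarrow>
       ((\<lambda>w. w powr \<alpha> * h2 w) has_field_derivative z powr \<alpha> * (- s * h1 z)) (at z)"
  shows "floquet_sys a b r \<kappa> s \<alpha> h1 h2 (ball 0 \<epsilon>)"
proof -
  \<comment> \<open>The right half of the disc avoids the branch cut and the origin and is open and
    nonempty, as the identity theorem requires.\<close>
  define W where "W = ball 0 \<epsilon> \<inter> {z::complex. Re z > 0}"
  have W: "open W" "W \<subseteq> ball 0 \<epsilon>" "of_real (\<epsilon>/2) \<in> W"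
    using eps(1) by (auto simp: W_def open_halfspace_Re_gt)
  have nz: "z \<noteq> 1" "z \<noteq> \<kappa>" if "z \<in> ball 0 \<epsilon>" for z
    using that eps by auto
  have dh: "(h has_field_derivative deriv h z) (at z)"
    if "h holomorphic_on ball 0 \<epsilon>" "z \<in> ball 0 \<epsilon>" for h z
    using that by (meson holomorphic_derivI open_ball)
  have key: "deriv h z = X - \<alpha> / z * h z"
    if z: "z \<in> W" and h: "h holomorphic_on ball 0 \<epsilon>"
      and d: "((\<lambda>w. w powr \<alpha> * h w) has_field_derivative z powr \<alpha> * X) (at z)" for h z X
  proof -
    have "z \<notin> \<real>\<^sub>\<le>\<^sub>0" "z \<noteq> 0"
      using z by (auto simp: W_def complex_nonpos_Reals_iff)
    then have "((\<lambda>w. w powr \<alpha> * h w) has_field_derivative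
           \<alpha> * z powr (\<alpha> - 1) * h z + deriv h z * z powr \<alpha>) (at z)"
      using z W(2) by (intro DERIV_mult has_field_derivative_powr dh h) auto
    from DERIV_unique[OF this d] have "z powr \<alpha> * (\<alpha> / z * h z + deriv h z) = z powr \<alpha> * X"
      using \<open>z \<noteq> 0\<close> by (simp add: powr_diff algebra_simps)
    then have "\<alpha> / z * h z + deriv h z = X"
      using \<open>z \<noteq> 0\<close> by simp
    then show ?thesis
      by (simp add: algebra_simps)
  qed
  have inW: "z \<in> ball 0 \<epsilon> - {z. Im z = 0 \<and> Re z \<le> 0}" if "z \<in> W" for z
    using that by (auto simp: W_def)
  have e1: "z * deriv h1 z = (- 1/2 - \<alpha>) * h1 z + a * h2 z
               + z / (z - 1) * (- 1/2 * h1 z + b * h2 z)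
               + z / (z - \<kappa>) * (- 1/2 * h1 z + r * h2 z)" if "z \<in> W" for z
  proof -
    have "z \<noteq> 0" using that by (auto simp: W_def)
    then show ?thesis
      unfolding key[OF that hol(1) sol1[OF inW[OF that]]]
      by (simp add: ring_distribs)
  qed
  have e2: "z * deriv h2 z = - \<alpha> * h2 z - s * z * h1 z" if "z \<in> W" for z
  proof -
    have "z \<noteq> 0" using that by (auto simp: W_def)
    then show ?thesis
      unfolding key[OF that hol(2) sol2[OF inW[OF that]]] by (simp add: algebra_simps)
  qed
  have ac: "f z = g z" if "f holomorphic_on ball 0 \<epsilon>" "g holomorphic_on ball 0 \<epsilon>"
      "\<And>z. z \<in> W \<Longrightarrow> f z = g z" "z \<in> ball 0 \<epsilon>" for f g z
    using analytic_continuation_open[OF W(1) open_ball _ connected_ball W(2) that] W(3) by blast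
  have q: "(\<lambda>z. z / (z - 1)) holomorphic_on ball 0 \<epsilon>" "(\<lambda>z. z / (z - \<kappa>)) holomorphic_on ball 0 \<epsilon>"
    using nz by (auto intro!: holomorphic_intros)
  have L: "(\<lambda>z. z * deriv h1 z) holomorphic_on ball 0 \<epsilon>" "(\<lambda>z. z * deriv h2 z) holomorphic_on ball 0 \<epsilon>"
    by (intro holomorphic_on_mult holomorphic_on_ident holomorphic_deriv hol open_ball)+
  have R1: "(\<lambda>z. (- 1/2 - \<alpha>) * h1 z + a * h2 z
               + z / (z - 1) * (- 1/2 * h1 z + b * h2 z)
               + z / (z - \<kappa>) * (- 1/2 * h1 z + r * h2 z)) holomorphic_on ball 0 \<epsilon>"
    by (intro holomorphic_on_mult holomorphic_on_add holomorphic_on_const hol q)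
  have R2: "(\<lambda>z. - \<alpha> * h2 z - s * z * h1 z) holomorphic_on ball 0 \<epsilon>"
    by (intro holomorphic_on_mult holomorphic_on_diff holomorphic_on_const holomorphic_on_ident hol)
  show ?thesis
    unfolding floquet_sys_def using ac[OF L(1) R1 e1] ac[OF L(2) R2 e2] by blast
qed

text \<open>The last hypothesis says \<open>G = g / (1 - q * z)\<close> without a quotient, so
  comparing power series gives the recurrence at once. It is used with \<open>q = 1\<close> and
  \<open>q = 1/\<kappa>\<close>.\<close>

lemma taylor_coeff_div_linear:
  assumes "g holomorphic_on ball 0 \<epsilon>" "G holomorphic_on ball 0 \<epsilon>" "0 < \<epsilon>"
    and "\<And>z. z \<in> ball 0 \<epsilon> \<Longrightarrow> G z = q * z * G z + g z"
  shows "taylor_coeff G (Suc k) = q * taylor_coeff G k + taylor_coeff g (Suc k)"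
proof -
  have "(\<lambda>z. q * z * G z + g z) has_fps_expansion
      fps_const q * fps_X * Abs_fps (taylor_coeff G) + Abs_fps (taylor_coeff g)"
    by (intro fps_expansion_intros has_fps_expansion_taylor_coeff[OF _ assms(3)] assms)
  note E = taylor_coeff_eqI[OF this]
  have "taylor_coeff G k = taylor_coeff (\<lambda>z. q * z * G z + g z) k" for k
    by (rule taylor_coeff_cong[OF _ assms(3)]) (rule assms(4))
  then have *: "taylor_coeff G k = fps_nth
      (fps_const q * fps_X * Abs_fps (taylor_coeff G) + Abs_fps (taylor_coeff g)) k" for k
    unfolding E .
  show "taylor_coeff G (Suc k) = q * taylor_coeff G k + taylor_coeff g (Suc k)"
    using *[of "Suc k"] by (simp add: mult.assoc)
qed

text \<open>Multiplying the system by \<open>(1 - z) powr (- \<beta>)\<close> and comparing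
  coefficients gives the first two equations. Differentiating the power adds \<open>\<beta>\<close>
  times the function behind \<open>d\<close>, which is the shift of the residue matrix at 1 by
  \<open>- \<beta>\<close>. The functions behind \<open>d\<close> and \<open>t\<close> are that
  behind \<open>u\<close> divided by \<open>1 - z\<close> and \<open>1 - z / \<kappa>\<close>;
  \<open>t\<close> is the sequence called \<open>s\<close> in the recurrences to be matched.\<close>

lemma floquet_sys_recurrence:
  fixes h1 h2 :: "complex \<Rightarrow> complex" and \<beta> :: complex
  assumes hol: "h1 holomorphic_on ball 0 \<epsilon>" "h2 holomorphic_on ball 0 \<epsilon>"
    and eps: "0 < \<epsilon>" "\<epsilon> \<le> 1" "\<epsilon> \<le> norm \<kappa>"
    and sys: "floquet_sys a b r \<kappa> s \<alpha> h1 h2 (ball 0 \<epsilon>)"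
  defines "u \<equiv> \<lambda>h. taylor_coeff (\<lambda>z. (1 - z) powr (- \<beta>) * h z)"
    and "d \<equiv> \<lambda>h. taylor_coeff (\<lambda>z. (1 - z) powr (- \<beta> - 1) * h z)"
    and "t \<equiv> \<lambda>h. taylor_coeff (\<lambda>z. (1 - z) powr (- \<beta>) * h z / (1 - z / \<kappa>))"
  shows "(- 1/2 - \<alpha> - of_nat (Suc k)) * u h1 (Suc k) + a * u h2 (Suc k) =
           (- 1/2 - \<beta>) * d h1 k + b * d h2 k + (1/\<kappa>) * (- 1/2 * t h1 k + r * t h2 k)"
    and "(- \<alpha> - of_nat (Suc k)) * u h2 (Suc k) = - \<beta> * d h2 k + s * u h1 k"
    and "\<And>h. h \<in> {h1, h2} \<Longrightarrow> d h (Suc k) = d h k + u h (Suc k)"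
    and "\<And>h. h \<in> {h1, h2} \<Longrightarrow> t h (Suc k) = (1/\<kappa>) * t h k + u h (Suc k)"
    and "\<And>h. h \<in> {h1, h2} \<Longrightarrow> u h 0 = h 0 \<and> d h 0 = h 0 \<and> t h 0 = h 0"
proof -
  define g where "g = (\<lambda>h (z::complex). (1 - z) powr (- \<beta>) * h z)"
  define D where "D = (\<lambda>h (z::complex). (1 - z) powr (- \<beta> - 1) * h z)"
  define T where "T = (\<lambda>h (z::complex). (1 - z) powr (- \<beta>) * h z / (1 - z / \<kappa>))"
  have utd: "u = (\<lambda>h. taylor_coeff (g h))" "d = (\<lambda>h. taylor_coeff (D h))" "t = (\<lambda>h. taylor_coeff (T h))"
    unfolding u_def d_def t_def g_def D_def T_def by simp_all
  have \<kappa>: "\<kappa> \<noteq> 0" using eps by auto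
  have nz: "z \<noteq> 1" "z \<noteq> \<kappa>" if "z \<in> ball 0 \<epsilon>" for z
    using that eps by auto
  have H: "h holomorphic_on ball 0 \<epsilon>" if "h \<in> {h1, h2}" for h
    using that hol by auto
  have gh: "g h holomorphic_on ball 0 \<epsilon>" "D h holomorphic_on ball 0 \<epsilon>"
           "T h holomorphic_on ball 0 \<epsilon>" if "h \<in> {h1, h2}" for h
    unfolding g_def D_def T_def using nz \<kappa>
    by (auto intro!: holomorphic_intros holomorphic_on_one_minus_powr H[OF that] eps(2)
      simp: holomorphic_on_one_minus_powr eps(2))
  have rD: "D h z = 1 * z * D h z + g h z" if "z \<in> ball 0 \<epsilon>" for h z
  proof -
    have "(1 - z) powr (- \<beta>) = (1 - z) powr (- \<beta> - 1) * (1 - z)"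
      using nz(1)[OF that] by (simp add: powr_diff)
    then show ?thesis unfolding D_def g_def by (simp only:) (simp add: algebra_simps)
  qed
  have rT: "T h z = 1/\<kappa> * z * T h z + g h z" if "z \<in> ball 0 \<epsilon>" for h z
    using nz(2)[OF that] \<kappa> by (simp add: T_def g_def divide_simps) (simp add: algebra_simps)
  show "d h (Suc k) = d h k + u h (Suc k)" if "h \<in> {h1, h2}" for h
    using taylor_coeff_div_linear[OF gh(1,2)[OF that] eps(1) rD] by (simp add: utd)
  show "t h (Suc k) = (1/\<kappa>) * t h k + u h (Suc k)" if "h \<in> {h1, h2}" for h
    using taylor_coeff_div_linear[OF gh(1,3)[OF that] eps(1) rT] by (simp add: utd)
  show "u h 0 = h 0 \<and> d h 0 = h 0 \<and> t h 0 = h 0" for h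
    by (simp add: u_def d_def t_def taylor_coeff_def)
  have dg: "deriv (g h) z = (1 - z) powr (- \<beta>) * deriv h z + \<beta> * D h z"
    if "z \<in> ball 0 \<epsilon>" "h \<in> {h1, h2}" for z h
  proof -
    have "(h has_field_derivative deriv h z) (at z)"
      using H[OF that(2)] that(1) by (meson holomorphic_derivI open_ball)
    moreover have "z \<in> ball 0 1" using that eps by auto
    ultimately show ?thesis
      unfolding g_def D_def
      by (intro DERIV_imp_deriv)
         (auto intro!: DERIV_cong[OF DERIV_mult] has_field_derivative_one_minus_powr
           simp: algebra_simps)
  qed
  \<comment> \<open>The poles at 1 and \<open>\<kappa>\<close> are absorbed into \<open>D\<close>
    and \<open>T\<close>; the explicit factor \<open>z\<close> left over produces the index shift
    from \<open>Suc k\<close> to \<open>k\<close>.\<close>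
  have q: "z / (z - 1) * g h z = - z * D h z" "z / (z - \<kappa>) * g h z = - (1/\<kappa>) * z * T h z"
    if "z \<in> ball 0 \<epsilon>" for z h
  proof -
    have "g h z = (1 - z) * D h z" using rD[OF that, of h] by (simp add: algebra_simps)
    then show "z / (z - 1) * g h z = - z * D h z"
      using nz(1)[OF that] by (simp add: divide_simps) (simp add: algebra_simps)
    show "z / (z - \<kappa>) * g h z = - (1/\<kappa>) * z * T h z"
      using nz(2)[OF that] \<kappa> by (simp add: T_def g_def divide_simps) (simp add: algebra_simps)
  qed
  have s1: "z * deriv (g h1) z = (- 1/2 - \<alpha>) * g h1 z + a * g h2 z
      - z * ((- 1/2 - \<beta>) * D h1 z + b * D h2 z) - z * ((1/\<kappa>) * (- 1/2 * T h1 z + r * T h2 z))"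
    if z: "z \<in> ball 0 \<epsilon>" for z
  proof -
    have "z * deriv (g h1) z = (1 - z) powr (- \<beta>) * (z * deriv h1 z) + \<beta> * z * D h1 z"
      by (subst dg[OF z]) (auto simp: algebra_simps)
    also have "z * deriv h1 z = (- 1/2 - \<alpha>) * h1 z + a * h2 z
               + z / (z - 1) * (- 1/2 * h1 z + b * h2 z)
               + z / (z - \<kappa>) * (- 1/2 * h1 z + r * h2 z)"
      using sys z by (auto simp: floquet_sys_def)
    also have "(1 - z) powr (- \<beta>) * \<dots> = (- 1/2 - \<alpha>) * g h1 z + a * g h2 z
        + (- 1/2) * (z / (z - 1) * g h1 z) + b * (z / (z - 1) * g h2 z)
        + (- 1/2) * (z / (z - \<kappa>) * g h1 z) + r * (z / (z - \<kappa>) * g h2 z)"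
      unfolding g_def by (simp only: ring_distribs mult_ac) (simp only: diff_conv_add_uminus add_ac)
    finally show ?thesis
      unfolding q[OF z] by (simp add: algebra_simps)
  qed
  have s2: "z * deriv (g h2) z = - \<alpha> * g h2 z + z * (\<beta> * D h2 z) - z * (s * g h1 z)"
    if z: "z \<in> ball 0 \<epsilon>" for z
  proof -
    have "z * deriv (g h2) z = (1 - z) powr (- \<beta>) * (z * deriv h2 z) + \<beta> * z * D h2 z"
      by (subst dg[OF z]) (auto simp: algebra_simps)
    also have "z * deriv h2 z = - \<alpha> * h2 z - s * z * h1 z"
      using sys z by (auto simp: floquet_sys_def)
    finally show ?thesis
      by (simp add: algebra_simps g_def)
  qed
  let ?F = "\<lambda>f. Abs_fps (taylor_coeff f)"
  have F: "g h has_fps_expansion ?F (g h)" "D h has_fps_expansion ?F (D h)"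
    "T h has_fps_expansion ?F (T h)" if "h \<in> {h1, h2}" for h
    using gh[OF that] by (auto intro: has_fps_expansion_taylor_coeff eps(1))
  have A1: "(\<lambda>z. z * deriv (g h1) z) has_fps_expansion fps_X * fps_deriv (?F (g h1))"
    by (intro fps_expansion_intros F) auto
  have B1: "(\<lambda>z. (- 1/2 - \<alpha>) * g h1 z + a * g h2 z
      - z * ((- 1/2 - \<beta>) * D h1 z + b * D h2 z) - z * ((1/\<kappa>) * (- 1/2 * T h1 z + r * T h2 z)))
      has_fps_expansion (fps_const (- 1/2 - \<alpha>) * ?F (g h1) + fps_const a * ?F (g h2)
      - fps_X * (fps_const (- 1/2 - \<beta>) * ?F (D h1) + fps_const b * ?F (D h2))
      - fps_X * (fps_const (1/\<kappa>) * (fps_const (- 1/2) * ?F (T h1) + fps_const r * ?F (T h2))))"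
    by (intro fps_expansion_intros F) auto
  have "fps_nth (fps_X * fps_deriv (?F (g h1))) (Suc k) =
     fps_nth (fps_const (- 1/2 - \<alpha>) * ?F (g h1) + fps_const a * ?F (g h2)
      - fps_X * (fps_const (- 1/2 - \<beta>) * ?F (D h1) + fps_const b * ?F (D h2))
      - fps_X * (fps_const (1/\<kappa>) * (fps_const (- 1/2) * ?F (T h1) + fps_const r * ?F (T h2)))) (Suc k)"
    unfolding taylor_coeff_eqI[OF A1, symmetric] taylor_coeff_eqI[OF B1, symmetric]
    by (rule taylor_coeff_cong[OF _ eps(1)]) (rule s1)
  then show "(- 1/2 - \<alpha> - of_nat (Suc k)) * u h1 (Suc k) + a * u h2 (Suc k) =
           (- 1/2 - \<beta>) * d h1 k + b * d h2 k + (1/\<kappa>) * (- 1/2 * t h1 k + r * t h2 k)"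
    by (simp add: utd algebra_simps)
  have A2: "(\<lambda>z. z * deriv (g h2) z) has_fps_expansion fps_X * fps_deriv (?F (g h2))"
    by (intro fps_expansion_intros F) auto
  have B2: "(\<lambda>z. - \<alpha> * g h2 z + z * (\<beta> * D h2 z) - z * (s * g h1 z))
      has_fps_expansion (fps_const (- \<alpha>) * ?F (g h2) + fps_X * (fps_const \<beta> * ?F (D h2))
      - fps_X * (fps_const s * ?F (g h1)))"
    by (intro fps_expansion_intros F) auto
  have "fps_nth (fps_X * fps_deriv (?F (g h2))) (Suc k) =
     fps_nth (fps_const (- \<alpha>) * ?F (g h2) + fps_X * (fps_const \<beta> * ?F (D h2))
      - fps_X * (fps_const s * ?F (g h1))) (Suc k)"
    unfolding taylor_coeff_eqI[OF A2, symmetric] taylor_coeff_eqI[OF B2, symmetric]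
    by (rule taylor_coeff_cong[OF _ eps(1)]) (rule s2)
  then show "(- \<alpha> - of_nat (Suc k)) * u h2 (Suc k) = - \<beta> * d h2 k + s * u h1 k"
    by (simp add: utd algebra_simps)
qed

section \<open>Matching the recurrences for \<open>dseq\<close> and \<open>dseq_t\<close>\<close>

lemma vec2_nth [simp]: "vec2 a b $ 1 = a" "vec2 a b $ 2 = b"
  by (simp_all add: vec2_def)

lemma mat2_nth [simp]: "mat2 a b c d $ 1 $ 1 = a" "mat2 a b c d $ 1 $ 2 = b"
    "mat2 a b c d $ 2 $ 1 = c" "mat2 a b c d $ 2 $ 2 = d"
  by (simp_all add: mat2_def)

lemma vec2_eq_iff: "x = y \<longleftrightarrow> x $ 1 = y $ 1 \<and> x $ 2 = y $ (2::2)"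
  by (simp add: vec_eq_iff forall_2)

text \<open>Turns the application of an inverse into the check of a triangular linear system, which
  is the form in which \<open>floquet_sys_recurrence\<close> supplies the next coefficients.\<close>

lemma matrix_inv_mat2_upper:
  assumes "p \<noteq> 0" "q \<noteq> 0" "p * x1 + a * x2 = w $ 1" "q * x2 = w $ 2"
  shows "matrix_inv (mat2 p a 0 q) *v w = vec2 x1 x2"
proof -
  have "mat2 p a 0 q ** mat2 (1/p) (-a/(p*q)) 0 (1/q) = mat 1"
       "mat2 (1/p) (-a/(p*q)) 0 (1/q) ** mat2 p a 0 q = mat 1"
    using assms(1,2) by (simp_all add: vec_eq_iff forall_2 matrix_matrix_mult_def sum_2 mat_def field_simps)
  then have "invertible (mat2 p a 0 q)"
    unfolding invertible_def by blast
  then have "matrix_inv (mat2 p a 0 q) ** mat2 p a 0 q = mat 1"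
    unfolding invertible_def matrix_inv_def by (metis (mono_tags, lifting) someI_ex)
  moreover have "w = mat2 p a 0 q *v vec2 x1 x2"
    using assms(3,4) by (simp add: vec2_eq_iff matrix_vector_mult_def sum_2)
  ultimately show ?thesis
    by (simp add: matrix_vector_mul_assoc)
qed

lemma mat2_add_mat: "mat2 a b c d + mat e = mat2 (a + e) b c (d + e)"
  by (simp add: vec_eq_iff forall_2 mat_def)

lemma mat2_mult_nth: "(mat2 a b c d *v x) $ 1 = a * x $ 1 + b * x $ 2"
    "(mat2 a b c d *v x) $ 2 = c * x $ 1 + d * x $ 2"
  by (simp_all add: matrix_vector_mult_def sum_2)

text \<open>These are the diagonal entries of the matrices inverted in both recurrences. Both are
  negative reals, as \<open>\<rho> / 2\<close> is at most 1/2.\<close>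

lemma of_nat_half_diff_neq_0: "\<rho> \<in> {0, 1} \<Longrightarrow> of_nat \<rho> / 2 - of_nat (Suc k) \<noteq> (0::complex)"
    "\<rho> \<in> {0, 1} \<Longrightarrow> - 1/2 + (of_nat \<rho> / 2 - of_nat (Suc k)) \<noteq> (0::complex)"
proof -
  assume "\<rho> \<in> {0, 1}"
  then have "real \<rho> / 2 - real (Suc k) \<noteq> 0" "- 1/2 + (real \<rho> / 2 - real (Suc k)) \<noteq> 0"
    by auto
  then have "complex_of_real (real \<rho> / 2 - real (Suc k)) \<noteq> 0"
    "complex_of_real (- 1/2 + (real \<rho> / 2 - real (Suc k))) \<noteq> 0"
    unfolding of_real_eq_0_iff .
  then show "of_nat \<rho> / 2 - of_nat (Suc k) \<noteq> (0::complex)"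
    "- 1/2 + (of_nat \<rho> / 2 - of_nat (Suc k)) \<noteq> (0::complex)"
    by simp_all
qed

text \<open>With this \<open>\<beta>\<close> the shift \<open>- \<beta>\<close> is the term
  \<open>1/2 - \<sigma>/2\<close> added to \<open>B\<close>, and the exponent
  \<open>- \<rho>/2\<close> gives the matrix to be inverted. The induction runs over the whole
  triple, because each new \<open>u\<close> uses all three predecessors.\<close>

lemma dseq_eq_taylor_coeff:
  fixes h1 h2 :: "complex \<Rightarrow> complex"
  assumes hol: "h1 holomorphic_on ball 0 \<epsilon>" "h2 holomorphic_on ball 0 \<epsilon>"
    and eps: "0 < \<epsilon>" "\<epsilon> \<le> 1" "\<epsilon> \<le> c"
    and rho: "\<rho> \<in> {0, 1}"
    and sys: "floquet_sys (a12 lam mu gam c) (b12 lam mu gam c) (r12 lam mu gam c) (of_real c)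
                (1 / of_real c) (- of_nat \<rho> / 2) h1 h2 (ball 0 \<epsilon>)"
    and init: "vec_a0 lam mu gam c \<rho> = vec2 (h1 0) (h2 0)"
    and \<beta>: "\<beta> = (of_nat \<sigma> - 1) / 2"
  shows "dseq lam mu gam c \<rho> \<sigma> k =
     vec2 (taylor_coeff (\<lambda>z. (1 - z) powr (- \<beta> - 1) * h1 z) k)
          (taylor_coeff (\<lambda>z. (1 - z) powr (- \<beta> - 1) * h2 z) k)"
proof -
  have eps': "\<epsilon> \<le> norm (complex_of_real c)" using eps by simp
  note rec = floquet_sys_recurrence[OF hol eps(1,2) eps' sys, where \<beta> = \<beta>]
  define u where "u h = taylor_coeff (\<lambda>z. (1 - z) powr (- \<beta>) * h z)" for h
  define d where "d h = taylor_coeff (\<lambda>z. (1 - z) powr (- \<beta> - 1) * h z)" for h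
  define t where "t h = taylor_coeff (\<lambda>z. (1 - z) powr (- \<beta>) * h z / (1 - z / of_real c))" for h
  note rec = rec[folded u_def d_def t_def]
  have "usd lam mu gam c \<rho> \<sigma> k =
     (vec2 (u h1 k) (u h2 k), vec2 (t h1 k) (t h2 k), vec2 (d h1 k) (d h2 k))"
  proof (induction k)
    case 0
    then show ?case
      using rec(5)[where h = h1] rec(5)[where h = h2] by (simp add: init Let_def)
  next
    case (Suc k)
    let ?w = "(matB lam mu gam c + mat (1/2 - of_nat \<sigma> / 2)) *v vec2 (d h1 k) (d h2 k)
                  + (1/of_real c) *s (matS *v vec2 (u h1 k) (u h2 k))
                  + (1/of_real c) *s (matR lam mu gam c *v vec2 (t h1 k) (t h2 k))"
    have \<beta>': "- \<beta> = 1/2 - of_nat \<sigma> / 2" "- 1/2 - \<beta> = - 1/2 + (1/2 - of_nat \<sigma> / 2)"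
      by (simp_all add: \<beta> diff_divide_distrib)
    have "matrix_inv (matA lam mu gam c + mat (of_nat \<rho> / 2 - of_nat (Suc k))) *v ?w
        = vec2 (u h1 (Suc k)) (u h2 (Suc k))"
      unfolding matA_def mat2_add_mat add_0
    proof (rule matrix_inv_mat2_upper)
      show "(- 1/2 + (of_nat \<rho> / 2 - of_nat (Suc k))) * u h1 (Suc k)
              + a12 lam mu gam c * u h2 (Suc k) = ?w $ 1"
        using rec(1)[where k = k] unfolding \<beta>'
        by (simp add: matB_def matS_def matR_def mat2_add_mat mat2_mult_nth)
      show "(of_nat \<rho> / 2 - of_nat (Suc k)) * u h2 (Suc k) = ?w $ 2"
        using rec(2)[where k = k] unfolding \<beta>'
        by (simp add: matB_def matS_def matR_def mat2_add_mat mat2_mult_nth)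
    qed (use of_nat_half_diff_neq_0[OF rho] in auto)
    then show ?case
      using rec(3,4)[where h = h1 and k = k] rec(3,4)[where h = h2 and k = k]
      by (simp add: Suc.IH Let_def vec2_eq_iff)
  qed
  then show ?thesis
    by (simp add: dseq_def d_def)
qed

text \<open>The mirror image at 1. Here \<open>- \<beta>\<close> is the shift
  \<open>\<rho>/2 + 1\<close> of \<open>A\<close>, and \<open>- \<beta> - 1\<close> is
  \<open>\<rho>/2\<close>, so in the reflected variable the power is the factor
  \<open>z powr (\<rho>/2)\<close> with no singularity at the expansion point.\<close>

lemma dseq_t_eq_taylor_coeff:
  fixes h1 h2 :: "complex \<Rightarrow> complex"
  assumes hol: "h1 holomorphic_on ball 0 \<epsilon>" "h2 holomorphic_on ball 0 \<epsilon>"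
    and eps: "0 < \<epsilon>" "\<epsilon> \<le> 1" "\<epsilon> \<le> c - 1"
    and sigma: "\<sigma> \<in> {0, 1}"
    and sys: "floquet_sys (b12 lam mu gam c) (a12 lam mu gam c) (r12 lam mu gam c) (1 - of_real c)
                (- 1 / of_real c) (- of_nat \<sigma> / 2) h1 h2 (ball 0 \<epsilon>)"
    and init: "vec_b2 lam mu gam c \<sigma> = vec2 (h1 0) (h2 0)"
    and \<beta>: "\<beta> = - of_nat \<rho> / 2 - 1"
  shows "dseq_t lam mu gam c \<rho> \<sigma> k =
     vec2 (taylor_coeff (\<lambda>z. (1 - z) powr (- \<beta> - 1) * h1 z) k)
          (taylor_coeff (\<lambda>z. (1 - z) powr (- \<beta> - 1) * h2 z) k)"
proof -
  have "norm (1 - complex_of_real c) = \<bar>1 - c\<bar>"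
    by (metis norm_of_real of_real_1 of_real_diff)
  then have eps': "\<epsilon> \<le> norm (1 - complex_of_real c)" using eps by simp
  note rec = floquet_sys_recurrence[OF hol eps(1,2) eps' sys, where \<beta> = \<beta>]
  define u where "u h = taylor_coeff (\<lambda>z. (1 - z) powr (- \<beta>) * h z)" for h
  define d where "d h = taylor_coeff (\<lambda>z. (1 - z) powr (- \<beta> - 1) * h z)" for h
  define t where "t h = taylor_coeff (\<lambda>z. (1 - z) powr (- \<beta>) * h z / (1 - z / (1 - of_real c)))" for h
  note rec = rec[folded u_def d_def t_def]
  have "usd_t lam mu gam c \<rho> \<sigma> k =
     (vec2 (u h1 k) (u h2 k), vec2 (t h1 k) (t h2 k), vec2 (d h1 k) (d h2 k))"
  proof (induction k)
    case 0
    then show ?case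
      using rec(5)[where h = h1] rec(5)[where h = h2] by (simp add: init Let_def)
  next
    case (Suc k)
    let ?w = "(matA lam mu gam c + mat (of_nat \<rho> / 2 + 1)) *v vec2 (d h1 k) (d h2 k)
                  - (1/of_real c) *s (matS *v vec2 (u h1 k) (u h2 k))
                  + (1/(1 - of_real c)) *s (matR lam mu gam c *v vec2 (t h1 k) (t h2 k))"
    have \<beta>': "- \<beta> = of_nat \<rho> / 2 + 1" "- 1/2 - \<beta> = - 1/2 + (of_nat \<rho> / 2 + 1)"
      by (simp_all add: \<beta>)
    have "matrix_inv (matB lam mu gam c + mat (of_nat \<sigma> / 2 - of_nat (Suc k))) *v ?w
        = vec2 (u h1 (Suc k)) (u h2 (Suc k))"
      unfolding matB_def mat2_add_mat add_0
    proof (rule matrix_inv_mat2_upper)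
      show "(- 1/2 + (of_nat \<sigma> / 2 - of_nat (Suc k))) * u h1 (Suc k)
              + b12 lam mu gam c * u h2 (Suc k) = ?w $ 1"
        using rec(1)[where k = k] unfolding \<beta>'
        by (simp add: matA_def matS_def matR_def mat2_add_mat mat2_mult_nth)
      show "(of_nat \<sigma> / 2 - of_nat (Suc k)) * u h2 (Suc k) = ?w $ 2"
        using rec(2)[where k = k] unfolding \<beta>'
        by (simp add: matA_def matS_def matR_def mat2_add_mat mat2_mult_nth)
    qed (use of_nat_half_diff_neq_0[OF sigma] in auto)
    then show ?case
      using rec(3,4)[where h = h1 and k = k] rec(3,4)[where h = h2 and k = k]
      by (simp add: Suc.IH Let_def vec2_eq_iff)
  qed
  then show ?thesis
    by (simp add: dseq_t_def d_def)
qed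

section \<open>Decay of Taylor coefficients\<close>

lemma taylor_coeff_deriv: "taylor_coeff f (Suc k) = taylor_coeff (deriv f) k / of_nat (Suc k)"
  by (simp add: taylor_coeff_def funpow_swap1 divide_simps)

text \<open>Cauchy's inequality on circles of radius \<open>r < 1\<close>, followed by the limit
  \<open>r\<close> to 1, since \<open>f\<close> need not extend to the closed disc.\<close>

lemma norm_taylor_coeff_le:
  assumes hol: "f holomorphic_on ball 0 1" and bd: "\<And>z. z \<in> ball 0 1 \<Longrightarrow> norm (f z) \<le> C"
  shows "norm (taylor_coeff f k) \<le> C"
proof -
  have *: "norm (taylor_coeff f k) * r ^ k \<le> C" if r: "0 < r" "r < 1" for r
  proof -
    have sub: "cball 0 r \<subseteq> ball (0::complex) 1" using r by auto
    have "norm ((deriv ^^ k) f 0) \<le> fact k * C / r ^ k"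
    proof (rule Cauchy_inequality)
      show "f holomorphic_on ball 0 r"
        using hol sub by (meson ball_subset_cball holomorphic_on_subset order_trans)
      show "continuous_on (cball 0 r) f"
        using hol sub by (meson holomorphic_on_imp_continuous_on holomorphic_on_subset)
    qed (use r bd in auto)
    then show ?thesis
      using r by (simp add: taylor_coeff_def norm_divide divide_simps mult_ac)
  qed
  \<comment> \<open>The radii start at 1/2, so that each of them is strictly between 0 and
    1.\<close>
  have "(\<lambda>n. norm (taylor_coeff f k) * (1 - 1 / real (Suc (Suc n))) ^ k) \<longlonglongrightarrow>
        norm (taylor_coeff f k) * (1 - 0) ^ k"
    by (intro tendsto_intros LIMSEQ_Suc[OF LIMSEQ_Suc[OF lim_1_over_n]])
  then have "norm (taylor_coeff f k) * (1 - 0) ^ k \<le> C"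
    by (rule LIMSEQ_le_const2) (use * in force)
  then show ?thesis by simp
qed

text \<open>Coefficient \<open>j\<close> of the derivative is \<open>j + 1\<close> times coefficient
  \<open>j + 1\<close> of \<open>f\<close>, so each bounded derivative is worth one power of the
  index. The weight \<open>Suc k\<close> stays positive at index 0.\<close>

lemma taylor_coeff_decay:
  assumes "f holomorphic_on ball 0 1"
    and "\<And>z. z \<in> ball 0 1 \<Longrightarrow> norm ((deriv ^^ m) f z) \<le> C"
  shows "\<exists>K. \<forall>k. norm (taylor_coeff f k) * real (Suc k) ^ m \<le> K"
  using assms
proof (induction m arbitrary: f)
  case 0
  then show ?case
    using norm_taylor_coeff_le[of f C] by auto
next
  case (Suc m)
  have "deriv f holomorphic_on ball 0 1"
    using Suc.prems(1) by (intro holomorphic_deriv) auto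
  moreover have "norm ((deriv ^^ m) (deriv f) z) \<le> C" if "z \<in> ball 0 1" for z
    using Suc.prems(2)[OF that] by (simp add: funpow_swap1)
  ultimately obtain K where K: "\<And>k. norm (taylor_coeff (deriv f) k) * real (Suc k) ^ m \<le> K"
    using Suc.IH by blast
  \<comment> \<open>The factor \<open>2 ^ Suc m\<close> pays for
    \<open>j + 2 \<le> 2 * (j + 1)\<close> when \<open>k = Suc j\<close>; index 0 is covered by
    \<open>norm (f 0)\<close>.\<close>
  have "norm (taylor_coeff f k) * real (Suc k) ^ Suc m \<le> max (norm (f 0)) (2 ^ Suc m * K)" for k
  proof (cases k)
    case 0
    then show ?thesis by (simp add: taylor_coeff_def)
  next
    case (Suc j)
    have "norm (taylor_coeff f k) * real (Suc k) ^ Suc m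
        \<le> norm (taylor_coeff f k) * (2 * real (Suc j)) ^ Suc m"
      using Suc by (intro mult_left_mono power_mono) auto
    also have "\<dots> = 2 ^ Suc m * (norm (taylor_coeff (deriv f) j) * real (Suc j) ^ m)"
    proof -
      have "norm (taylor_coeff f k) = norm (taylor_coeff (deriv f) j) / real (Suc j)"
        unfolding Suc taylor_coeff_deriv norm_divide norm_of_nat ..
      then show ?thesis
        by (simp add: power_mult_distrib del: of_nat_Suc)
    qed
    also have "\<dots> \<le> 2 ^ Suc m * K"
      by (intro mult_left_mono K) auto
    finally show ?thesis by linarith
  qed
  then show ?case by blast
qed

lemma higher_deriv_step:
  assumes "open U" "z \<in> U" "\<And>w. w \<in> U \<Longrightarrow> (deriv ^^ m) f w = g w"
    "(g has_field_derivative D) (at z)"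
  shows "(deriv ^^ Suc m) f z = D"
proof -
  have "eventually (\<lambda>w. w \<in> U) (nhds z)"
    using assms by (intro eventually_nhds_in_open)
  then have "eventually (\<lambda>w. (deriv ^^ m) f w = g w) (nhds z)"
    by eventually_elim (rule assms(3))
  then have "deriv ((deriv ^^ m) f) z = deriv g z"
    by (intro deriv_cong_ev) auto
  then show ?thesis
    using DERIV_imp_deriv[OF assms(4)] by simp
qed

text \<open>Each differentiation lowers the exponent by one and changes only the regular factor.
  That factor stays holomorphic on \<open>V\<close>, which may contain 1, so the power alone carries
  the singularity.\<close>

lemma higher_deriv_one_minus_powr_mult:
  fixes G :: "complex \<Rightarrow> complex"
  assumes U: "open U" "U \<subseteq> ball 0 1" "U \<subseteq> V" and V: "open V" "G holomorphic_on V"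
  shows "\<exists>G'. G' holomorphic_on V \<and>
     (\<forall>z\<in>U. (deriv ^^ m) (\<lambda>z. (1 - z) powr e * G z) z = (1 - z) powr (e - of_nat m) * G' z)"
proof (induction m)
  case 0
  then show ?case using V by (intro exI[of _ G]) auto
next
  case (Suc m)
  then obtain G' where G': "G' holomorphic_on V"
    "\<And>z. z \<in> U \<Longrightarrow> (deriv ^^ m) (\<lambda>z. (1 - z) powr e * G z) z = (1 - z) powr (e - of_nat m) * G' z"
    by blast
  \<comment> \<open>What remains of the product rule once
    \<open>(1 - z) powr (e - of_nat m - 1)\<close> is factored out.\<close>
  let ?G = "\<lambda>z. - (e - of_nat m) * G' z + (1 - z) * deriv G' z"
  have "?G holomorphic_on V"
    using G' V by (intro holomorphic_intros) auto
  moreover have "(deriv ^^ Suc m) (\<lambda>z. (1 - z) powr e * G z) z = (1 - z) powr (e - of_nat (Suc m)) * ?G z"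
    if z: "z \<in> U" for z
  proof (rule higher_deriv_step[where g = "\<lambda>z. (1 - z) powr (e - of_nat m) * G' z", OF U(1) z])
    have z1: "z \<in> ball 0 1" "z \<in> V" "z \<noteq> 1" using z U by auto
    have "(G' has_field_derivative deriv G' z) (at z)"
      using G'(1) V(1) z1 by (meson holomorphic_derivI)
    note D = DERIV_mult[OF has_field_derivative_one_minus_powr[OF z1(1)] this]
    have "(1 - z) powr (e - of_nat m) = (1 - z) powr (e - of_nat m - 1) * (1 - z)"
      using z1 by (simp add: powr_diff)
    moreover have "e - of_nat (Suc m) = e - of_nat m - 1" by simp
    ultimately show "((\<lambda>z. (1 - z) powr (e - of_nat m) * G' z) has_field_derivative
          (1 - z) powr (e - of_nat (Suc m)) * ?G z) (at z)"
      by (intro DERIV_cong[OF D]) (simp only:, simp add: algebra_simps)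
  qed (rule G'(2))
  ultimately show ?case by blast
qed

text \<open>The function \<open>exp (- L * t) * N t\<close> has nonpositive derivative.\<close>

lemma gronwall_exp:
  fixes N N' :: "real \<Rightarrow> real"
  assumes "a \<le> b"
    and "\<And>t. a \<le> t \<Longrightarrow> t \<le> b \<Longrightarrow> (N has_real_derivative N' t) (at t)"
    and "\<And>t. a \<le> t \<Longrightarrow> t \<le> b \<Longrightarrow> N' t \<le> L * N t"
  shows "N b \<le> exp (L * (b - a)) * N a"
proof -
  have "exp (- L * b) * N b \<le> exp (- L * a) * N a"
  proof (rule DERIV_nonpos_imp_nonincreasing[OF assms(1)])
    fix t assume t: "a \<le> t" "t \<le> b"
    have "((\<lambda>t. exp (- L * t) * N t) has_real_derivative exp (- L * t) * (N' t - L * N t)) (at t)"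
      by (rule DERIV_cong[OF DERIV_mult[OF _ assms(2)[OF t], where Da = "- L * exp (- L * t)"]])
         (auto intro!: derivative_eq_intros simp: algebra_simps)
    moreover have "exp (- L * t) * (N' t - L * N t) \<le> 0"
      using assms(3)[OF t] by (intro mult_nonneg_nonpos) auto
    ultimately show "\<exists>y. ((\<lambda>t. exp (- L * t) * N t) has_real_derivative y) (at t) \<and> y \<le> 0"
      by blast
  qed
  then have "exp (L * b) * (exp (- L * b) * N b) \<le> exp (L * b) * (exp (- L * a) * N a)"
    by (intro mult_left_mono) auto
  moreover have "exp (L * b) * exp (- L * b) = 1"
    by (simp flip: exp_add)
  moreover have "exp (L * b) * exp (- L * a) = exp (L * (b - a))"
    by (simp flip: exp_add add: right_diff_distrib)
  ultimately show ?thesis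
    by (metis mult.assoc mult_1)
qed

text \<open>The square keeps the modulus differentiable at zeros of \<open>\<phi>\<close>, so it is
  the quantity to feed into Gronwall's inequality.\<close>

lemma has_real_derivative_cmod_square:
  fixes \<phi> :: "real \<Rightarrow> complex"
  assumes "(\<phi> has_vector_derivative d) (at t)"
  shows "((\<lambda>t. (norm (\<phi> t))\<^sup>2) has_real_derivative 2 * (\<phi> t \<bullet> d)) (at t)"
proof -
  have "((\<lambda>t. \<phi> t \<bullet> \<phi> t) has_derivative (\<lambda>h. \<phi> t \<bullet> (h *\<^sub>R d) + (h *\<^sub>R d) \<bullet> \<phi> t)) (at t)"
    using assms unfolding has_vector_derivative_def by (intro has_derivative_inner)
  then show ?thesis
    unfolding has_field_derivative_def power2_norm_eq_inner
    by (rule has_derivative_eq_rhs) (auto simp: inner_commute algebra_simps)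
qed

section \<open>Solutions away from the singularity at 1\<close>

text \<open>Division by \<open>z\<close> exposes the rational coefficients. What later arguments
  need of them is holomorphy off the three finite singularities, in particular at boundary points of
  the unit disc other than 1.\<close>

lemma floquet_sys_imp_linear:
  assumes "floquet_sys a b r \<kappa> s \<alpha> h1 h2 (ball 0 1)" "norm \<kappa> > 1"
  obtains n11 n12 n21 n22 where
    "n11 holomorphic_on - {0, 1, \<kappa>}" "n12 holomorphic_on - {0, 1, \<kappa>}"
    "n21 holomorphic_on - {0, 1, \<kappa>}" "n22 holomorphic_on - {0, 1, \<kappa>}"
    "\<And>z. z \<in> ball 0 1 - {0} \<Longrightarrow> deriv h1 z = n11 z * h1 z + n12 z * h2 z"
    "\<And>z. z \<in> ball 0 1 - {0} \<Longrightarrow> deriv h2 z = n21 z * h1 z + n22 z * h2 z"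
proof
  let ?n11 = "\<lambda>z. (- 1/2 - \<alpha>) / z + (- 1/2) / (z - 1) + (- 1/2) / (z - \<kappa>)"
  let ?n12 = "\<lambda>z. a / z + b / (z - 1) + r / (z - \<kappa>)"
  let ?n22 = "\<lambda>z. - \<alpha> / z"
  show "?n11 holomorphic_on - {0, 1, \<kappa>}" "?n12 holomorphic_on - {0, 1, \<kappa>}"
       "(\<lambda>_. - s) holomorphic_on - {0, 1, \<kappa>}" "?n22 holomorphic_on - {0, 1, \<kappa>}"
    by (auto intro!: holomorphic_intros)
  fix z :: complex assume z: "z \<in> ball 0 1 - {0}"
  then have nz: "z \<noteq> 0" "z \<noteq> 1" "z \<noteq> \<kappa>"
    using assms(2) by auto
  have S: "z * deriv h1 z = (- 1/2 - \<alpha>) * h1 z + a * h2 z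
               + z / (z - 1) * (- 1/2 * h1 z + b * h2 z)
               + z / (z - \<kappa>) * (- 1/2 * h1 z + r * h2 z)"
          "z * deriv h2 z = - \<alpha> * h2 z - s * z * h1 z"
    using assms(1) z by (auto simp: floquet_sys_def)
  have "z * (?n11 z * h1 z + ?n12 z * h2 z) =
      (z * ((- 1/2 - \<alpha>) / z)) * h1 z + (z * (a / z)) * h2 z
               + z / (z - 1) * (- 1/2 * h1 z + b * h2 z)
               + z / (z - \<kappa>) * (- 1/2 * h1 z + r * h2 z)"
    by (simp only: divide_inverse ring_distribs mult_ac add_ac)
  then have "z * deriv h1 z = z * (?n11 z * h1 z + ?n12 z * h2 z)"
    using S(1) nz(1) by simp
  then show "deriv h1 z = ?n11 z * h1 z + ?n12 z * h2 z"
    using nz(1) by (metis mult_left_cancel)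
  have "z * deriv h2 z = z * (- s * h1 z + ?n22 z * h2 z)"
    unfolding S(2) using nz(1) by (simp add: algebra_simps)
  then show "deriv h2 z = - s * h1 z + ?n22 z * h2 z"
    using nz(1) by (metis mult_left_cancel)
qed

text \<open>For positive \<open>r\<close> and \<open>norm \<kappa> > 1\<close> this set misses 0, 1
  and \<open>\<kappa>\<close>, so the coefficients of the linear system are bounded on it up to the
  unit circle.\<close>

lemma compact_annulus: "compact {z::complex. 1/4 \<le> norm z \<and> norm z \<le> 1 \<and> r \<le> norm (1 - z)}"
proof -
  have "closed {z::complex. 1/4 \<le> norm z \<and> norm z \<le> 1 \<and> r \<le> norm (1 - z)}"
    by (intro closed_Collect_conj closed_Collect_le continuous_intros)
  moreover have "bounded {z::complex. 1/4 \<le> norm z \<and> norm z \<le> 1 \<and> r \<le> norm (1 - z)}"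
    by (rule boundedI[of _ 1]) auto
  ultimately show ?thesis by (simp add: compact_eq_bounded_closed)
qed

lemma continuous_on_compact_norm_bound:
  fixes f :: "'a::topological_space \<Rightarrow> 'b::real_normed_vector"
  assumes "continuous_on K f" "compact K"
  obtains B where "\<And>z. z \<in> K \<Longrightarrow> norm (f z) \<le> B" "B \<ge> 0"
proof -
  have "bounded (f ` K)"
    using assms compact_continuous_image compact_imp_bounded by blast
  then obtain B where "\<And>z. z \<in> K \<Longrightarrow> norm (f z) \<le> B"
    unfolding bounded_iff by auto
  then show ?thesis
    by (intro that[of "max B 0"]) (auto simp: le_max_iff_disj)
qed

context
  fixes h1 h2 n11 n12 n21 n22 :: "complex \<Rightarrow> complex" and \<kappa> :: complex
  assumes h: "h1 holomorphic_on ball 0 1" "h2 holomorphic_on ball 0 1"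
    and n: "n11 holomorphic_on - {0, 1, \<kappa>}" "n12 holomorphic_on - {0, 1, \<kappa>}"
      "n21 holomorphic_on - {0, 1, \<kappa>}" "n22 holomorphic_on - {0, 1, \<kappa>}"
    and lin1: "\<And>z. z \<in> ball 0 1 - {0} \<Longrightarrow> deriv h1 z = n11 z * h1 z + n12 z * h2 z"
    and lin2: "\<And>z. z \<in> ball 0 1 - {0} \<Longrightarrow> deriv h2 z = n21 z * h1 z + n22 z * h2 z"
    and \<kappa>: "norm \<kappa> > 1"
begin

text \<open>The combinations of \<open>h1\<close> and \<open>h2\<close> with coefficients
  holomorphic off the singularities are closed under differentiation, because the system
  re-expresses \<open>deriv h1\<close> and \<open>deriv h2\<close>. Bounds for all derivatives thus
  reduce to bounds for \<open>h1\<close> and \<open>h2\<close>.\<close>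

lemma higher_deriv_linear_system:
  fixes e :: complex
  assumes "p holomorphic_on - {0, 1, \<kappa>}" "q holomorphic_on - {0, 1, \<kappa>}"
  shows "\<exists>p' q'. p' holomorphic_on - {0, 1, \<kappa>} \<and> q' holomorphic_on - {0, 1, \<kappa>} \<and>
     (\<forall>z\<in>ball 0 1 - {0}. (deriv ^^ m) (\<lambda>z. (1 - z) powr e * (p z * h1 z + q z * h2 z)) z =
        (1 - z) powr e * (p' z * h1 z + q' z * h2 z))"
proof (induction m)
  case 0
  then show ?case using assms by (intro exI[of _ p] exI[of _ q]) auto
next
  case (Suc m)
  let ?V = "- {0, 1, \<kappa>}"
  have oV: "open ?V" by (simp add: open_Compl)
  from Suc obtain p' q' where pq: "p' holomorphic_on ?V" "q' holomorphic_on ?V"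
     "\<And>z. z \<in> ball 0 1 - {0} \<Longrightarrow>
       (deriv ^^ m) (\<lambda>z. (1 - z) powr e * (p z * h1 z + q z * h2 z)) z =
        (1 - z) powr e * (p' z * h1 z + q' z * h2 z)"
    by blast
  let ?p = "\<lambda>z. - e / (1 - z) * p' z + deriv p' z + p' z * n11 z + q' z * n21 z"
  let ?q = "\<lambda>z. - e / (1 - z) * q' z + deriv q' z + p' z * n12 z + q' z * n22 z"
  have "(\<lambda>z. - e / (1 - z)) holomorphic_on ?V"
    by (auto intro!: holomorphic_intros)
  then have "?p holomorphic_on ?V" "?q holomorphic_on ?V"
    by (intro holomorphic_on_add holomorphic_on_mult holomorphic_deriv pq(1,2) n oV; assumption)+
  moreover have "(deriv ^^ Suc m) (\<lambda>z. (1 - z) powr e * (p z * h1 z + q z * h2 z)) z =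
        (1 - z) powr e * (?p z * h1 z + ?q z * h2 z)" if z: "z \<in> ball 0 1 - {0}" for z
  proof (rule higher_deriv_step[where U = "ball 0 1 - {0}"
        and g = "\<lambda>z. (1 - z) powr e * (p' z * h1 z + q' z * h2 z)", OF _ z])
    show "((\<lambda>z. (1 - z) powr e * (p' z * h1 z + q' z * h2 z)) has_field_derivative
        (1 - z) powr e * (?p z * h1 z + ?q z * h2 z)) (at z)"
    proof -
      have zz: "z \<in> ball 0 1" "z \<in> ?V" "z \<noteq> 1" using z \<kappa> by auto
      have d: "(p' has_field_derivative deriv p' z) (at z)" "(q' has_field_derivative deriv q' z) (at z)"
        "(h1 has_field_derivative n11 z * h1 z + n12 z * h2 z) (at z)"
        "(h2 has_field_derivative n21 z * h1 z + n22 z * h2 z) (at z)"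
        using holomorphic_derivI[OF pq(1) oV zz(2)] holomorphic_derivI[OF pq(2) oV zz(2)]
          holomorphic_derivI[OF h(1) open_ball zz(1)] holomorphic_derivI[OF h(2) open_ball zz(1)]
          lin1[OF z] lin2[OF z] by auto
      have pw: "(1 - z) powr (e - 1) = (1 - z) powr e / (1 - z)"
        using zz by (simp add: powr_diff)
      show ?thesis
        by (rule DERIV_cong[OF DERIV_mult[OF has_field_derivative_one_minus_powr[OF zz(1)]
              DERIV_add[OF DERIV_mult[OF d(1) d(3)] DERIV_mult[OF d(2) d(4)]]]])
           (simp add: pw algebra_simps add_divide_distrib)
    qed
  qed (use pq(3) in auto)
  ultimately show ?case by blast
qed

text \<open>Gronwall's inequality along the segment from \<open>z / 2\<close> to \<open>z\<close>, on which
  \<open>norm (1 - z) \<le> 2 * norm (1 - t * z)\<close> keeps the coefficients bounded.\<close>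

lemma linear_system_bounded:
  assumes "r > 0"
  obtains B where "\<And>z. z \<in> ball 0 1 \<Longrightarrow> 1/2 \<le> norm z \<Longrightarrow> r \<le> norm (1 - z) \<Longrightarrow>
      norm (h1 z) \<le> B \<and> norm (h2 z) \<le> B" "B \<ge> 0"
proof -
  \<comment> \<open>For \<open>t\<close> and \<open>norm z\<close> at least 1/2, the point
    \<open>t * z\<close> has norm at least 1/4, and it loses at most half of the distance
    \<open>r\<close> from 1.\<close>
  let ?K = "{z::complex. 1/4 \<le> norm z \<and> norm z \<le> 1 \<and> r/2 \<le> norm (1 - z)}"
  have sub: "?K \<subseteq> - {0, 1, \<kappa>}" using assms \<kappa> by auto
  note bnd = continuous_on_compact_norm_bound[OF continuous_on_subset[OF
        holomorphic_on_imp_continuous_on sub] compact_annulus]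
  obtain B1 where B1: "\<And>z. z \<in> ?K \<Longrightarrow> norm (n11 z) \<le> B1" "B1 \<ge> 0" using bnd[OF n(1)] by blast
  obtain B2 where B2: "\<And>z. z \<in> ?K \<Longrightarrow> norm (n12 z) \<le> B2" "B2 \<ge> 0" using bnd[OF n(2)] by blast
  obtain B3 where B3: "\<And>z. z \<in> ?K \<Longrightarrow> norm (n21 z) \<le> B3" "B3 \<ge> 0" using bnd[OF n(3)] by blast
  obtain B4 where B4: "\<And>z. z \<in> ?K \<Longrightarrow> norm (n22 z) \<le> B4" "B4 \<ge> 0" using bnd[OF n(4)] by blast
  note B0 = B1(2) B2(2) B3(2) B4(2)
  define L where "L = B1 + B2 + B3 + B4"
  have L: "L \<ge> 0" "\<And>z. z \<in> ?K \<Longrightarrow> norm (n11 z) \<le> L \<and> norm (n12 z) \<le> L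
      \<and> norm (n21 z) \<le> L \<and> norm (n22 z) \<le> L"
  proof -
    show "L \<ge> 0" using B0 by (simp add: L_def)
    fix z assume z: "z \<in> ?K"
    show "norm (n11 z) \<le> L \<and> norm (n12 z) \<le> L \<and> norm (n21 z) \<le> L \<and> norm (n22 z) \<le> L"
      unfolding L_def using B0 B1(1)[OF z] B2(1)[OF z] B3(1)[OF z] B4(1)[OF z] by linarith
  qed
  have sub2: "cball 0 (1/2) \<subseteq> ball (0::complex) 1" by auto
  obtain C1 where C1: "\<And>z. z \<in> cball 0 (1/2) \<Longrightarrow> norm (h1 z) \<le> C1"
    using continuous_on_compact_norm_bound[OF continuous_on_subset[OF
        holomorphic_on_imp_continuous_on[OF h(1)] sub2] compact_cball] by blast
  obtain C2 where C2: "\<And>z. z \<in> cball 0 (1/2) \<Longrightarrow> norm (h2 z) \<le> C2"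
    using continuous_on_compact_norm_bound[OF continuous_on_subset[OF
        holomorphic_on_imp_continuous_on[OF h(2)] sub2] compact_cball] by blast
  \<comment> \<open>Gronwall with rate \<open>4 * L\<close> over the parameter interval from 1/2 to
    1; the starting point \<open>z / 2\<close> lies in the disc on which \<open>C1\<close> and
    \<open>C2\<close> are bounds.\<close>
  define M where "M = exp (4 * L * (1 - 1/2)) * (C1\<^sup>2 + C2\<^sup>2)"
  have M0: "M \<ge> 0" by (simp add: M_def)
  show ?thesis
  proof (rule that[of "sqrt M"])
    fix z :: complex assume z: "z \<in> ball 0 1" "1/2 \<le> norm z" "r \<le> norm (1 - z)"
    define N where "N = (\<lambda>t::real. (norm (h1 (of_real t * z)))\<^sup>2 + (norm (h2 (of_real t * z)))\<^sup>2)"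
    define N' where "N' = (\<lambda>t::real. 2 * (h1 (of_real t * z) \<bullet> (z * deriv h1 (of_real t * z)))
         + 2 * (h2 (of_real t * z) \<bullet> (z * deriv h2 (of_real t * z))))"
    have inball: "of_real t * z \<in> ball 0 1 - {0}" and inK: "of_real t * z \<in> ?K"
      if t: "1/2 \<le> t" "t \<le> 1" for t :: real
    proof -
      have nt: "norm (of_real t * z) = t * norm z" using t by (simp add: norm_mult)
      have le: "t * norm z \<le> norm z" using t by (intro mult_left_le_one_le) auto
      have ge: "1/4 \<le> t * norm z" using mult_mono[OF t(1) z(2)] t by simp
      \<comment> \<open>On a ray the second summand equals \<open>norm z - t * norm z\<close>. This
        is at most \<open>1 - norm (t * z)\<close>, hence at most \<open>norm (1 - t * z)\<close>,
        which gives the factor 2.\<close>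
      have "norm (1 - z) \<le> norm (1 - of_real t * z) + norm (of_real t * z - z)"
        using norm_triangle_ineq[of "1 - of_real t * z" "of_real t * z - z"] by simp
      also have "of_real t * z - z = - (of_real (1 - t) * z)" by (simp add: algebra_simps)
      also have "norm \<dots> = norm z - t * norm z"
        using t by (simp only: norm_minus_cancel norm_mult norm_of_real) (simp add: algebra_simps)
      also have "\<dots> \<le> 1 - norm (of_real t * z)" using z(1) nt by simp
      also have "\<dots> \<le> norm (1 - of_real t * z)"
        using norm_triangle_ineq2[of 1 "of_real t * z"] by simp
      finally show "of_real t * z \<in> ?K" using nt le ge z by simp
      show "of_real t * z \<in> ball 0 1 - {0}" using nt le z ge t by auto
    qed
    have "N 1 \<le> exp (4 * L * (1 - 1/2)) * N (1/2)"
    proof (rule gronwall_exp[where N' = N'])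
      fix t :: real assume t: "1/2 \<le> t" "t \<le> 1"
      have V: "((\<lambda>t::real. f (of_real t * z)) has_vector_derivative z * deriv f (of_real t * z)) (at t)"
        if "f holomorphic_on ball 0 1" for f
      proof -
        have "(f has_field_derivative deriv f (of_real t * z)) (at (of_real t * z))"
          using inball[OF t] that by (meson DiffD1 holomorphic_derivI open_ball)
        moreover have "((\<lambda>w. w * z) has_field_derivative z) (at (of_real t))"
          by (auto intro!: derivative_eq_intros)
        ultimately have "((\<lambda>w. f (w * z)) has_field_derivative deriv f (of_real t * z) * z) (at (of_real t))"
          by (rule DERIV_chain2)
        from has_vector_derivative_real_field[OF this] show ?thesis by (simp add: mult.commute)
      qed
      show "(N has_real_derivative N' t) (at t)"
        unfolding N_def N'_def
        by (intro DERIV_add has_real_derivative_cmod_square V h)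
      let ?x = "norm (h1 (of_real t * z))" and ?y = "norm (h2 (of_real t * z))"
      note bL = L(2)[OF inK[OF t]]
      have d: "norm (z * deriv h1 (of_real t * z)) \<le> L * (?x + ?y)"
              "norm (z * deriv h2 (of_real t * z)) \<le> L * (?x + ?y)"
      proof -
        have *: "norm (z * (u * h1 (of_real t * z) + v * h2 (of_real t * z))) \<le> L * (?x + ?y)"
          if "norm u \<le> L" "norm v \<le> L" for u v
        proof -
          have "norm (z * (u * h1 (of_real t * z) + v * h2 (of_real t * z)))
              \<le> 1 * norm (u * h1 (of_real t * z) + v * h2 (of_real t * z))"
            unfolding norm_mult[of z] using z(1) by (intro mult_right_mono) auto
          also have "\<dots> \<le> norm u * ?x + norm v * ?y"
            using norm_triangle_ineq[of "u * h1 (of_real t * z)" "v * h2 (of_real t * z)"]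
            by (simp add: norm_mult)
          also have "\<dots> \<le> L * ?x + L * ?y"
            using that by (intro add_mono mult_right_mono) auto
          finally show ?thesis by (simp add: algebra_simps)
        qed
        show "norm (z * deriv h1 (of_real t * z)) \<le> L * (?x + ?y)"
          unfolding lin1[OF inball[OF t]] by (rule *) (use bL in auto)
        show "norm (z * deriv h2 (of_real t * z)) \<le> L * (?x + ?y)"
          unfolding lin2[OF inball[OF t]] by (rule *) (use bL in auto)
      qed
      have i: "x \<bullet> y \<le> norm x * (L * (?x + ?y))" if "norm y \<le> L * (?x + ?y)" for x y :: complex
        using norm_cauchy_schwarz[of x y] mult_left_mono[OF that norm_ge_zero[of x]] by linarith
      have "N' t \<le> 2 * (?x * (L * (?x + ?y))) + 2 * (?y * (L * (?x + ?y)))"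
        unfolding N'_def by (intro add_mono mult_left_mono i d) auto
      also have "\<dots> = L * (2 * (?x + ?y)\<^sup>2)" by (simp add: algebra_simps power2_eq_square)
      also have "\<dots> \<le> L * (4 * (?x\<^sup>2 + ?y\<^sup>2))"
      proof (intro mult_left_mono L(1))
        have "0 \<le> (?x - ?y)\<^sup>2" by simp
        then show "2 * (?x + ?y)\<^sup>2 \<le> 4 * (?x\<^sup>2 + ?y\<^sup>2)" by (simp add: algebra_simps power2_eq_square)
      qed
      finally show "N' t \<le> 4 * L * N t" by (simp add: N_def algebra_simps)
    qed simp
    also have "N (1/2) \<le> C1\<^sup>2 + C2\<^sup>2"
    proof -
      have "of_real (1/2) * z \<in> cball 0 (1/2)" using z(1) by (simp add: norm_mult)
      then show ?thesis unfolding N_def by (intro add_mono power_mono C1 C2) auto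
    qed
    finally have "N 1 \<le> M" by (simp add: M_def)
    then have "(norm (h1 z))\<^sup>2 + (norm (h2 z))\<^sup>2 \<le> M" by (simp add: N_def)
    moreover have "0 \<le> (norm (h1 z))\<^sup>2" "0 \<le> (norm (h2 z))\<^sup>2" by simp_all
    ultimately have "(norm (h1 z))\<^sup>2 \<le> M" "(norm (h2 z))\<^sup>2 \<le> M" by linarith+
    then show "norm (h1 z) \<le> sqrt M \<and> norm (h2 z) \<le> sqrt M"
      by (simp add: real_le_rsqrt)
  qed (simp add: M0)
qed

text \<open>On the disc of radius 1/2 holomorphy suffices. Outside it the derivative is a
  combination of \<open>h1\<close> and \<open>h2\<close>, with coefficients bounded by compactness
  and solutions bounded by Gronwall.\<close>

lemma higher_deriv_bounded_away:
  fixes e :: complex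
  assumes r: "r > 0" and k: "k \<in> {h1, h2}"
  shows "\<exists>C. \<forall>z\<in>ball 0 1. r \<le> norm (1 - z) \<longrightarrow> norm ((deriv ^^ m) (\<lambda>z. (1 - z) powr e * k z) z) \<le> C"
proof -
  let ?K = "{z::complex. 1/4 \<le> norm z \<and> norm z \<le> 1 \<and> r \<le> norm (1 - z)}"
  let ?f = "\<lambda>z. (1 - z) powr e * k z"
  \<comment> \<open>Constant coefficients that select the component \<open>k\<close>.\<close>
  define p q where "p = (\<lambda>z::complex. if k = h1 then 1 else 0 :: complex)"
    and "q = (\<lambda>z::complex. if k = h1 then 0 else 1 :: complex)"
  have "p holomorphic_on - {0, 1, \<kappa>}" "q holomorphic_on - {0, 1, \<kappa>}"
    unfolding p_def q_def by (auto intro!: holomorphic_intros)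
  from higher_deriv_linear_system[OF this, of m e]
  obtain p' q' where pq: "p' holomorphic_on - {0, 1, \<kappa>}" "q' holomorphic_on - {0, 1, \<kappa>}"
    "\<And>z. z \<in> ball 0 1 - {0} \<Longrightarrow> (deriv ^^ m) (\<lambda>z. (1 - z) powr e * (p z * h1 z + q z * h2 z)) z =
        (1 - z) powr e * (p' z * h1 z + q' z * h2 z)" by blast
  have kk: "(\<lambda>z. (1 - z) powr e * (p z * h1 z + q z * h2 z)) = ?f"
    using k by (auto simp: p_def q_def fun_eq_iff)
  note D = pq(3)[unfolded kk]
  have sub: "?K \<subseteq> - {0, 1, \<kappa>}" using assms \<kappa> by auto
  have PQ': "continuous_on ?K (\<lambda>z. (1 - z) powr e * p' z)" "continuous_on ?K (\<lambda>z. (1 - z) powr e * q' z)"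
  proof -
    have P: "continuous_on ?K (\<lambda>z. (1 - z) powr e)"
    proof (rule holomorphic_on_imp_continuous_on, intro holomorphic_intros)
      show "1 - z \<notin> \<real>\<^sub>\<le>\<^sub>0" if "z \<in> ?K" for z :: complex
        by (rule one_minus_notin_nonpos_Reals) (use that r in auto)
    qed
    have "continuous_on ?K p'" "continuous_on ?K q'"
      using pq(1,2) sub holomorphic_on_imp_continuous_on continuous_on_subset by blast+
    then show "continuous_on ?K (\<lambda>z. (1 - z) powr e * p' z)" "continuous_on ?K (\<lambda>z. (1 - z) powr e * q' z)"
      using P by (auto intro: continuous_on_mult)
  qed
  obtain P where P: "\<And>z. z \<in> ?K \<Longrightarrow> norm ((1 - z) powr e * p' z) \<le> P" "P \<ge> 0"
    using continuous_on_compact_norm_bound[OF PQ'(1) compact_annulus] by blast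
  obtain Q where Q: "\<And>z. z \<in> ?K \<Longrightarrow> norm ((1 - z) powr e * q' z) \<le> Q" "Q \<ge> 0"
    using continuous_on_compact_norm_bound[OF PQ'(2) compact_annulus] by blast
  obtain B where B: "\<And>z. z \<in> ball 0 1 \<Longrightarrow> 1/2 \<le> norm z \<Longrightarrow> r \<le> norm (1 - z) \<Longrightarrow>
      norm (h1 z) \<le> B \<and> norm (h2 z) \<le> B" "B \<ge> 0"
    using linear_system_bounded[OF r] by blast
  have "(deriv ^^ m) ?f holomorphic_on ball 0 1"
    using k h by (intro holomorphic_higher_deriv holomorphic_on_mult holomorphic_on_one_minus_powr) auto
  then have "continuous_on (cball 0 (1/2)) ((deriv ^^ m) ?f)"
    by (intro continuous_on_subset[OF holomorphic_on_imp_continuous_on]) auto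
  then obtain B' where B': "\<And>z. z \<in> cball 0 (1/2) \<Longrightarrow> norm ((deriv ^^ m) ?f z) \<le> B'"
    using continuous_on_compact_norm_bound[OF _ compact_cball] by blast
  show ?thesis
  proof (intro exI ballI impI)
    fix z :: complex assume z: "z \<in> ball 0 1" "r \<le> norm (1 - z)"
    show "norm ((deriv ^^ m) ?f z) \<le> max B' (P * B + Q * B)"
    proof (cases "norm z \<le> 1/2")
      case True
      then show ?thesis using B'[of z] by simp
    next
      case False
      then have zK: "z \<in> ?K" "z \<in> ball 0 1 - {0}" using z by auto
      have "norm ((deriv ^^ m) ?f z) = norm (((1 - z) powr e * p' z) * h1 z + ((1 - z) powr e * q' z) * h2 z)"
        unfolding D[OF zK(2)] by (simp add: algebra_simps)
      also have "\<dots> \<le> norm ((1 - z) powr e * p' z) * norm (h1 z) + norm ((1 - z) powr e * q' z) * norm (h2 z)"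
        by (metis norm_mult norm_triangle_ineq)
      also have "\<dots> \<le> P * B + Q * B"
        using B(1)[OF z(1) _ z(2)] False P Q zK(1) by (intro add_mono mult_mono) auto
      finally show ?thesis by simp
    qed
  qed
qed

end

section \<open>Singular expansion at 1\<close>

text \<open>Two sets are kept apart: linearity of higher derivatives needs holomorphy on an open set
  \<open>U\<close>, whereas the bound is wanted only on a part \<open>A\<close> of it that keeps
  away from 1 or from the outer edge of a neighbourhood of 1.\<close>

definition bounded_higher_deriv ::
    "nat \<Rightarrow> complex set \<Rightarrow> complex set \<Rightarrow> (complex \<Rightarrow> complex) \<Rightarrow> bool" where
  "bounded_higher_deriv m U A f \<longleftrightarrow>
     f holomorphic_on U \<and> (\<exists>C. \<forall>z\<in>A. norm ((deriv ^^ m) f z) \<le> C)"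

context
  fixes U A :: "complex set"
  assumes U: "open U" "A \<subseteq> U"
begin

lemma bounded_higher_deriv_cong:
  assumes "bounded_higher_deriv m U A g" "\<And>z. z \<in> U \<Longrightarrow> f z = g z"
  shows "bounded_higher_deriv m U A f"
proof -
  have g: "g holomorphic_on U" using assms(1) by (simp add: bounded_higher_deriv_def)
  then have f: "f holomorphic_on U"
    using assms(2) by (simp cong: holomorphic_cong)
  have "(deriv ^^ m) f z = (deriv ^^ m) g z" if "z \<in> A" for z
    by (rule higher_deriv_transform_within_open[OF f g U(1)]) (use that U(2) assms(2) in auto)
  then show ?thesis
    using assms(1) f by (simp add: bounded_higher_deriv_def)
qed

lemma bounded_higher_deriv_cmult:
  assumes "bounded_higher_deriv m U A f"
  shows "bounded_higher_deriv m U A (\<lambda>z. a * f z)"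
proof -
  obtain C where f: "f holomorphic_on U" and C: "\<And>z. z \<in> A \<Longrightarrow> norm ((deriv ^^ m) f z) \<le> C"
    using assms by (auto simp: bounded_higher_deriv_def)
  have "norm ((deriv ^^ m) (\<lambda>z. a * f z) z) \<le> norm a * C" if "z \<in> A" for z
    using C[OF that] that U
    by (subst higher_deriv_cmult[OF f _ U(1)]) (auto simp: norm_mult intro!: mult_left_mono)
  then show ?thesis
    unfolding bounded_higher_deriv_def using f by (auto intro!: holomorphic_intros)
qed

lemma bounded_higher_deriv_add:
  assumes "bounded_higher_deriv m U A f" "bounded_higher_deriv m U A g"
  shows "bounded_higher_deriv m U A (\<lambda>z. f z + g z)"
proof -
  obtain C D where f: "f holomorphic_on U" "g holomorphic_on U"
    and C: "\<And>z. z \<in> A \<Longrightarrow> norm ((deriv ^^ m) f z) \<le> C" "\<And>z. z \<in> A \<Longrightarrow> norm ((deriv ^^ m) g z) \<le> D"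
    using assms by (auto simp: bounded_higher_deriv_def)
  have "norm ((deriv ^^ m) (\<lambda>z. f z + g z) z) \<le> C + D" if "z \<in> A" for z
    using C[OF that] that U
    by (subst higher_deriv_add[OF f U(1)]) (auto intro: norm_triangle_mono)
  then show ?thesis
    unfolding bounded_higher_deriv_def using f by (auto intro!: holomorphic_intros)
qed

lemma bounded_higher_deriv_diff:
  assumes "bounded_higher_deriv m U A f" "bounded_higher_deriv m U A g"
  shows "bounded_higher_deriv m U A (\<lambda>z. f z - g z)"
  using bounded_higher_deriv_add[OF assms(1) bounded_higher_deriv_cmult[OF assms(2), of "-1"]]
  by simp

lemma bounded_higher_deriv_sum:
  assumes "finite I" "\<And>i. i \<in> I \<Longrightarrow> bounded_higher_deriv m U A (f i)"
  shows "bounded_higher_deriv m U A (\<lambda>z. \<Sum>i\<in>I. f i z)"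
  using assms
proof (induction I rule: finite_induct)
  case empty
  then show ?case by (auto simp: bounded_higher_deriv_def)
next
  case (insert i I)
  then show ?case by (simp add: bounded_higher_deriv_add)
qed

end

text \<open>The quotient in the remainder is itself holomorphic at the centre, so its derivatives
  are bounded there as well; a mere order estimate of the remainder could not be
  differentiated.\<close>

lemma taylor_remainder:
  assumes "F holomorphic_on ball 0 r" "r > 0"
  shows "\<exists>K. K holomorphic_on ball 0 r \<and>
    (\<forall>x\<in>ball 0 r. F x = (\<Sum>l<N. taylor_coeff F l * x ^ l) + x ^ N * K x)"
proof (induction N)
  case 0
  then show ?case using assms by (intro exI[of _ F]) auto
next
  case (Suc N)
  then obtain K where K: "K holomorphic_on ball 0 r"
    "\<And>x. x \<in> ball 0 r \<Longrightarrow> F x = (\<Sum>l<N. taylor_coeff F l * x ^ l) + x ^ N * K x" by blast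
  \<comment> \<open>The difference quotient of \<open>K\<close>, with its removable singularity
    filled in; it is the next remainder, and \<open>K 0\<close> is the next coefficient.\<close>
  define L where "L = (\<lambda>x. if x = 0 then deriv K 0 else (K x - K 0) / (x - 0))"
  have L: "L holomorphic_on ball 0 r"
    unfolding L_def using assms(2) by (intro pole_lemma K) auto
  have KL: "K x = K 0 + x * L x" for x
    by (simp add: L_def)
  have "taylor_coeff F N = K 0"
  proof -
    have "taylor_coeff F N = taylor_coeff (\<lambda>x. (\<Sum>l<N. taylor_coeff F l * x ^ l) + x ^ N * K x) N"
      by (rule taylor_coeff_cong[OF _ assms(2)]) (rule K(2))
    also have "(\<lambda>x. (\<Sum>l<N. taylor_coeff F l * x ^ l) + x ^ N * K x) has_fps_expansion
        (\<Sum>l<N. fps_const (taylor_coeff F l) * fps_X ^ l) + fps_X ^ N * Abs_fps (taylor_coeff K)"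
      by (intro fps_expansion_intros has_fps_expansion_taylor_coeff[OF K(1) assms(2)])
    note taylor_coeff_eqI[OF this, of N]
    also have "fps_nth ((\<Sum>l<N. fps_const (taylor_coeff F l) * fps_X ^ l) + fps_X ^ N * Abs_fps (taylor_coeff K)) N
        = taylor_coeff K 0"
      by (simp add: fps_sum_nth fps_X_power_mult_nth)
    finally show ?thesis by (simp add: taylor_coeff_def)
  qed
  then have "F x = (\<Sum>l<Suc N. taylor_coeff F l * x ^ l) + x ^ Suc N * L x" if "x \<in> ball 0 r" for x
    using K(2)[OF that] KL[of x] by (simp add: algebra_simps)
  then show ?case using L by blast
qed

section \<open>Binomial coefficients of the powers of \<open>1 - z\<close>\<close>

lemma has_fps_expansion_one_minus_powr:
  fixes e :: complex
  shows "(\<lambda>z. (1 - z) powr e) has_fps_expansion Abs_fps (\<lambda>k. (- 1) ^ k * (e gchoose k))"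
proof (rule has_fps_expansionI)
  have "eventually (\<lambda>u. u \<in> ball 0 1) (nhds (0::complex))"
    by (intro eventually_nhds_in_open) auto
  then show "eventually (\<lambda>u. (\<lambda>n. fps_nth (Abs_fps (\<lambda>k. (- 1) ^ k * (e gchoose k))) n * u ^ n) sums
      (1 - u) powr e) (nhds 0)"
  proof eventually_elim
    case (elim u)
    then have "(\<lambda>n. (e gchoose n) * (- u) ^ n) sums (1 + - u) powr e"
      by (intro gen_binomial_complex) auto
    also have "(\<lambda>n. (e gchoose n) * (- u) ^ n) = (\<lambda>n. (- 1) ^ n * (e gchoose n) * u ^ n)"
      by (simp add: fun_eq_iff power_minus[of u])
    finally show ?case by simp
  qed
qed

lemma taylor_coeff_one_minus_powr:
  "taylor_coeff (\<lambda>z. (1 - z) powr e) k = (- 1) ^ k * (e gchoose k)"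
  using taylor_coeff_eqI[OF has_fps_expansion_one_minus_powr] by simp

text \<open>The simple pole is written as a power, so that the rules for the other singular terms
  apply to it too.\<close>

lemma taylor_coeff_geometric: "taylor_coeff (\<lambda>z. (1 - z) powr (- 1)) k = 1"
proof -
  have "(- 1 gchoose k) = (- 1 :: complex) ^ k"
    using gbinomial_minus[of "1::complex" k] by (simp add: gbinomial_of_nat_symmetric flip: binomial_gbinomial)
  then show ?thesis
    by (simp add: taylor_coeff_one_minus_powr flip: power_mult_distrib)
qed

text \<open>The absorption identity for generalised binomial coefficients; iterating it from the
  lowest exponent builds up the products in \<open>pvec\<close>.\<close>

lemma taylor_coeff_one_minus_powr_step:
  assumes "e + 1 \<noteq> of_nat k"
  shows "taylor_coeff (\<lambda>z. (1 - z) powr (e + 1)) k =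
     (e + 1) / (e + 1 - of_nat k) * taylor_coeff (\<lambda>z. (1 - z) powr e) k"
  using gbinomial_absorb_comp[of "e + 1" k] assms
  by (simp add: taylor_coeff_one_minus_powr field_simps)

text \<open>Immediate from the asymptotics of generalised binomial coefficients. Only the upper
  bound is kept, since the limiting constant may vanish.\<close>

lemma taylor_coeff_one_minus_powr_bigo:
  fixes e :: real
  shows "(\<lambda>k. taylor_coeff (\<lambda>z. (1 - z) powr (of_real e)) k) \<in> O(\<lambda>k. of_real (real k powr (- e - 1)))"
proof -
  have "(\<lambda>k. complex_of_real e gchoose k) \<in> O(\<lambda>n. (-1)^n / exp ((of_real e+1) * of_real (ln (real n))))"
    by (rule bigoI_tendsto[OF gbinomial_asymptotic]) auto
  then obtain C where C: "eventually (\<lambda>n. norm (complex_of_real e gchoose n) \<le>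
      C * norm ((-1)^n / exp ((complex_of_real e+1) * of_real (ln (real n))))) sequentially"
    by (elim landau_o.bigE)
  have ng: "norm ((-1)^n / exp ((complex_of_real e+1) * of_real (ln (real n)))) = real n powr (- e - 1)"
    if "n > 0" for n
  proof -
    have "norm ((-1)^n / exp ((complex_of_real e+1) * of_real (ln (real n)))) = exp (- ((e + 1) * ln (real n)))"
      by (simp add: norm_mult norm_inverse norm_power exp_minus divide_inverse norm_exp_eq_Re)
    also have "\<dots> = real n powr (- e - 1)"
      using that by (simp add: powr_def algebra_simps)
    finally show ?thesis .
  qed
  show ?thesis
  proof (rule bigoI[of _ C])
    show "eventually (\<lambda>k. norm (taylor_coeff (\<lambda>z. (1 - z) powr (of_real e)) k) \<le>
        C * norm (complex_of_real (real k powr (- e - 1)))) sequentially"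
      using C eventually_gt_at_top[of "0::nat"]
      by eventually_elim (simp only: ng, simp add: taylor_coeff_one_minus_powr norm_mult norm_power)
  qed
qed

lemma bigo_of_real_iff:
  fixes f :: "nat \<Rightarrow> complex"
  shows "f \<in> O(\<lambda>k. of_real (g k)) \<longleftrightarrow> (\<lambda>k. norm (f k)) \<in> O(g)"
  by (simp add: bigo_def)

text \<open>The derivative is again a power times an entire function, hence continuous on the closed
  disc with a neighbourhood of 1 removed.\<close>

lemma bounded_higher_deriv_one_minus_powr_away:
  assumes "\<epsilon> > 0"
  shows "bounded_higher_deriv m (ball 0 1) {z\<in>ball 0 1. \<epsilon> \<le> norm (1 - z)} (\<lambda>z. (1 - z) powr e)"
proof -
  let ?K = "{z::complex. norm z \<le> 1 \<and> \<epsilon> \<le> norm (1 - z)}"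
  obtain g where g: "g holomorphic_on UNIV"
    "\<And>z. z \<in> ball 0 1 \<Longrightarrow> (deriv ^^ m) (\<lambda>z. (1 - z) powr e * 1) z = (1 - z) powr (e - of_nat m) * g z"
    using higher_deriv_one_minus_powr_mult[of "ball 0 1" UNIV "\<lambda>_. 1" m e] by auto
  have "compact ?K"
  proof -
    have "closed ?K" by (intro closed_Collect_conj closed_Collect_le continuous_intros)
    moreover have "bounded ?K" by (rule boundedI[of _ 1]) auto
    ultimately show ?thesis by (simp add: compact_eq_bounded_closed)
  qed
  moreover have "continuous_on ?K (\<lambda>z. (1 - z) powr (e - of_nat m) * g z)"
  proof (intro continuous_on_mult)
    show "continuous_on ?K g"
      using g(1) holomorphic_on_imp_continuous_on continuous_on_subset by blast
    show "continuous_on ?K (\<lambda>z. (1 - z) powr (e - of_nat m))"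
    proof (rule holomorphic_on_imp_continuous_on, intro holomorphic_intros)
      show "1 - z \<notin> \<real>\<^sub>\<le>\<^sub>0" if "z \<in> ?K" for z :: complex
        by (rule one_minus_notin_nonpos_Reals) (use that assms in auto)
    qed
  qed
  ultimately obtain B where "\<And>z. z \<in> ?K \<Longrightarrow> norm ((1 - z) powr (e - of_nat m) * g z) \<le> B"
    using continuous_on_compact_norm_bound by blast
  then have "norm ((deriv ^^ m) (\<lambda>z. (1 - z) powr e) z) \<le> B" if "z \<in> ball 0 1" "\<epsilon> \<le> norm (1 - z)" for z
    using g(2)[OF that(1)] that by auto
  then show ?thesis
    unfolding bounded_higher_deriv_def by (auto intro!: holomorphic_on_one_minus_powr)
qed

section \<open>Darboux's method with a single singularity on the unit circle\<close>

context
  fixes f G1 G2 :: "complex \<Rightarrow> complex" and \<Theta> \<Omega> :: complex and r \<delta> :: real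
  assumes f: "f holomorphic_on ball 0 1"
    and G: "G1 holomorphic_on ball 1 r" "G2 holomorphic_on ball 1 r" and r: "0 < r"
    and near: "\<And>z. z \<in> ball 0 1 \<inter> ball 1 r \<Longrightarrow>
        f z = \<Theta> * (G1 z / (1 - z)) + \<Omega> * ((1 - z) powr (of_real \<delta> - 1) * G2 z)"
    and away: "\<And>m \<epsilon>. \<epsilon> > 0 \<Longrightarrow> \<exists>C. \<forall>z\<in>ball 0 1. \<epsilon> \<le> norm (1 - z) \<longrightarrow> norm ((deriv ^^ m) f z) \<le> C"
begin

text \<open>After subtraction of the singular terms, what is left near 1 is a holomorphic function
  plus one with factor \<open>(1 - z) powr (\<delta> + N)\<close>. Its derivative of order
  \<open>m\<close> is bounded because \<open>m\<close> does not exceed that exponent;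
  \<open>away\<close> covers the rest of the disc, and bounded derivatives mean decaying
  coefficients.\<close>

lemma darboux_expansion:
  assumes m: "real m \<le> \<delta> + real N"
  shows "\<exists>K. \<forall>k. norm (taylor_coeff f k - \<Theta> * G1 1 - \<Omega> *
      (\<Sum>l\<le>N. taylor_coeff (\<lambda>x. G2 (1 - x)) l * taylor_coeff (\<lambda>z. (1 - z) powr (of_real (\<delta> - 1 + real l))) k))
      * real (Suc k) ^ m \<le> K"
proof -
  define d where "d = taylor_coeff (\<lambda>x. G2 (1 - x))"
  define e where "e = (\<lambda>z. f z - \<Theta> * G1 1 * (1 - z) powr (- 1) - \<Omega> *
      (\<Sum>l\<le>N. d l * (1 - z) powr (of_real (\<delta> - 1 + real l))))"
  have tc: "taylor_coeff e k = taylor_coeff f k - \<Theta> * G1 1 - \<Omega> *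
      (\<Sum>l\<le>N. d l * taylor_coeff (\<lambda>z. (1 - z) powr (of_real (\<delta> - 1 + real l))) k)" for k
  proof -
    let ?W = "\<lambda>a. Abs_fps (taylor_coeff (\<lambda>z. (1 - z) powr a))"
    have W: "(\<lambda>z. (1 - z) powr a) has_fps_expansion ?W a" for a
      by (rule has_fps_expansion_taylor_coeff[OF holomorphic_on_one_minus_powr, of 1]) auto
    have "e has_fps_expansion Abs_fps (taylor_coeff f) - fps_const (\<Theta> * G1 1) * ?W (- 1) - fps_const \<Omega> *
      (\<Sum>l\<le>N. fps_const (d l) * ?W (of_real (\<delta> - 1 + real l)))"
      unfolding e_def
      by (intro has_fps_expansion_diff has_fps_expansion_cmult_left has_fps_expansion_sum W
            has_fps_expansion_taylor_coeff[OF f]) auto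
    from taylor_coeff_eqI[OF this] show ?thesis
      by (simp add: fps_sum_nth taylor_coeff_geometric)
  qed
  \<comment> \<open>Cutting at distance \<open>r/2\<close> covers the disc and keeps
    \<open>?A2\<close> inside a compact subset of \<open>ball 1 r\<close>.\<close>
  let ?A1 = "{z\<in>ball 0 1. r/2 \<le> norm (1 - z)}" and ?A2 = "ball 0 1 \<inter> cball (1::complex) (r/2)"
  have "bounded_higher_deriv m (ball 0 1) ?A1 e"
  proof -
    have sub: "?A1 \<subseteq> ball 0 1" by auto
    note rules = bounded_higher_deriv_diff[OF open_ball sub] bounded_higher_deriv_cmult[OF open_ball sub]
      bounded_higher_deriv_sum[OF open_ball sub]
    have "bounded_higher_deriv m (ball 0 1) ?A1 f"
      unfolding bounded_higher_deriv_def using f away[OF half_gt_zero[OF r], of m] by blast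
    then show ?thesis
      unfolding e_def
      using r by (intro rules bounded_higher_deriv_one_minus_powr_away) auto
  qed
  moreover have "bounded_higher_deriv m (ball 0 1 \<inter> ball 1 r) ?A2 e"
  proof -
    let ?U = "ball 0 1 \<inter> ball (1::complex) r"
    have oU: "open ?U" and sub: "?A2 \<subseteq> ?U" using r by auto
    \<comment> \<open>One Taylor term of \<open>G1\<close> is enough: division by
      \<open>1 - z\<close> then leaves a function holomorphic at 1.\<close>
    obtain K1 where K1: "K1 holomorphic_on ball 0 r"
      "\<And>x. x \<in> ball 0 r \<Longrightarrow> G1 (1 - x) = (\<Sum>l<1. taylor_coeff (\<lambda>x. G1 (1 - x)) l * x ^ l) + x ^ 1 * K1 x"
      using taylor_remainder[of "\<lambda>x. G1 (1 - x)" r 1] holomorphic_on_reflect[of G1 0 r] G(1) r by auto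
    obtain K2 where K2: "K2 holomorphic_on ball 0 r"
      "\<And>x. x \<in> ball 0 r \<Longrightarrow> G2 (1 - x) = (\<Sum>l<Suc N. d l * x ^ l) + x ^ Suc N * K2 x"
      using taylor_remainder[of "\<lambda>x. G2 (1 - x)" r "Suc N"] holomorphic_on_reflect[of G2 0 r] G(2) r unfolding d_def by auto
    define P1 P2 where "P1 = (\<lambda>z. K1 (1 - z))" and "P2 = (\<lambda>z. K2 (1 - z))"
    have P: "P1 holomorphic_on ball 1 r" "P2 holomorphic_on ball 1 r"
      unfolding P1_def P2_def using holomorphic_on_reflect[of K1 1 r] holomorphic_on_reflect[of K2 1 r] K1 K2 by auto
    have G1e: "G1 z = G1 1 + (1 - z) * P1 z" if "z \<in> ?U" for z
      using K1(2)[of "1 - z"] that by (simp add: P1_def taylor_coeff_def dist_norm norm_minus_commute)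
    have G2e: "G2 z = (\<Sum>l\<le>N. d l * (1 - z) ^ l) + (1 - z) ^ Suc N * P2 z" if "z \<in> ?U" for z
      using K2(2)[of "1 - z"] that by (simp add: P2_def lessThan_Suc_atMost dist_norm norm_minus_commute)
    have eq: "e z = \<Theta> * P1 z + \<Omega> * ((1 - z) powr (of_real (\<delta> + real N)) * P2 z)" if z: "z \<in> ?U" for z
    proof -
      have nz: "1 - z \<noteq> 0" using z by auto
      have pw: "(1 - z) powr (of_real \<delta> - 1) * (1 - z) ^ l = (1 - z) powr (of_real (\<delta> - 1 + real l))" for l
        using nz by (simp add: powr_add flip: powr_complexpow)
      have "(1 - z) powr (of_real \<delta> - 1) * G2 z
          = (\<Sum>l\<le>N. d l * ((1 - z) powr (of_real \<delta> - 1) * (1 - z) ^ l))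
            + ((1 - z) powr (of_real \<delta> - 1) * (1 - z) ^ Suc N) * P2 z"
        unfolding G2e[OF z] by (simp add: sum_distrib_left algebra_simps)
      also have "\<dots> = (\<Sum>l\<le>N. d l * (1 - z) powr (of_real (\<delta> - 1 + real l)))
            + (1 - z) powr (of_real (\<delta> + real N)) * P2 z"
        unfolding pw by simp
      finally have A: "(1 - z) powr (of_real \<delta> - 1) * G2 z = \<dots>" .
      have B: "G1 z / (1 - z) = G1 1 * (1 - z) powr (- 1) + P1 z"
        unfolding G1e[OF z] using nz by (simp add: powr_minus divide_simps)
      show ?thesis
        unfolding e_def near[OF z] A B by (simp add: algebra_simps)
    qed
    have sub': "?A2 \<subseteq> cball 1 (r/2)" "cball 1 (r/2) \<subseteq> ball (1::complex) r" using r by auto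
    have "bounded_higher_deriv m ?U ?A2 P1"
    proof -
      have "(deriv ^^ m) P1 holomorphic_on ball 1 r" by (intro holomorphic_higher_deriv P open_ball)
      then obtain B where "\<And>z. z \<in> cball 1 (r/2) \<Longrightarrow> norm ((deriv ^^ m) P1 z) \<le> B"
        using continuous_on_compact_norm_bound[OF continuous_on_subset[OF
           holomorphic_on_imp_continuous_on sub'(2)] compact_cball] by blast
      then show ?thesis
        unfolding bounded_higher_deriv_def using holomorphic_on_subset[OF P(1) Int_lower2] by blast
    qed
    moreover have "bounded_higher_deriv m ?U ?A2 (\<lambda>z. (1 - z) powr (of_real (\<delta> + real N)) * P2 z)"
    proof -
      obtain g where g: "g holomorphic_on ball 1 r"
        "\<And>z. z \<in> ?U \<Longrightarrow> (deriv ^^ m) (\<lambda>z. (1 - z) powr (of_real (\<delta> + real N)) * P2 z) z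
           = (1 - z) powr (of_real (\<delta> + real N) - of_nat m) * g z"
        using higher_deriv_one_minus_powr_mult[OF oU _ _ open_ball P(2), of m "of_real (\<delta> + real N)"]
        by auto
      obtain B where B: "\<And>z. z \<in> cball 1 (r/2) \<Longrightarrow> norm (g z) \<le> B"
        using continuous_on_compact_norm_bound[OF continuous_on_subset[OF
           holomorphic_on_imp_continuous_on[OF g(1)] sub'(2)] compact_cball] by blast
      have "norm ((deriv ^^ m) (\<lambda>z. (1 - z) powr (of_real (\<delta> + real N)) * P2 z) z)
          \<le> 2 powr (\<delta> + real N - real m) * B" if z: "z \<in> ?A2" for z
      proof -
        \<comment> \<open>The exponent is real, so no argument of \<open>1 - z\<close> enters the
          modulus; it is nonnegative by \<open>m\<close>, so the power is largest at the crude bound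
          2 for \<open>norm (1 - z)\<close>.\<close>
        have "norm ((1 - z) powr (of_real (\<delta> + real N) - of_nat m)) = norm (1 - z) powr (\<delta> + real N - real m)"
          by (subst norm_powr_real_powr') auto
        also have "\<dots> \<le> 2 powr (\<delta> + real N - real m)"
        proof (rule powr_mono2)
          have "norm (1 - z) \<le> norm (1::complex) + norm z" by (rule norm_triangle_ineq4)
          then show "norm (1 - z) \<le> 2" using z by simp
        qed (use m in auto)
        finally have le: "norm ((1 - z) powr (of_real (\<delta> + real N) - of_nat m)) \<le> 2 powr (\<delta> + real N - real m)" .
        have "z \<in> ?U" "z \<in> cball 1 (r/2)" using z sub by blast+
        then show ?thesis
          unfolding g(2)[OF \<open>z \<in> ?U\<close>] norm_mult by (intro mult_mono le B) auto
      qed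
      moreover have "(\<lambda>z. (1 - z) powr (of_real (\<delta> + real N)) * P2 z) holomorphic_on ?U"
        using P(2) holomorphic_on_one_minus_powr[of 1]
        by (intro holomorphic_on_mult) (auto intro: holomorphic_on_subset)
      ultimately show ?thesis
        unfolding bounded_higher_deriv_def by blast
    qed
    ultimately show ?thesis
      by (intro bounded_higher_deriv_cong[OF oU sub _ eq] bounded_higher_deriv_add[OF oU sub]
          bounded_higher_deriv_cmult[OF oU sub])
  qed
  ultimately obtain C1 C2 where "\<And>z. z \<in> ?A1 \<Longrightarrow> norm ((deriv ^^ m) e z) \<le> C1"
      "\<And>z. z \<in> ?A2 \<Longrightarrow> norm ((deriv ^^ m) e z) \<le> C2" and e: "e holomorphic_on ball 0 1"
    unfolding bounded_higher_deriv_def by blast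
  note C = this(1,2)
  have "norm ((deriv ^^ m) e z) \<le> max C1 C2" if "z \<in> ball 0 1" for z
    using C(1)[of z] C(2)[of z] that by (cases "r/2 \<le> norm (1 - z)") (auto simp: dist_norm le_max_iff_disj)
  from taylor_coeff_decay[OF e this] show ?thesis
    unfolding tc d_def .
qed

end

section \<open>The connection coefficient\<close>

lemma solves_onD:
  assumes "solves_on lam mu gam c y U" "z \<in> U"
  shows "((\<lambda>w. y w $ 1) has_field_derivative
           (1/z) * (- 1/2 * y z $ 1 + a12 lam mu gam c * y z $ 2)
           + (1/(z - 1)) * (- 1/2 * y z $ 1 + b12 lam mu gam c * y z $ 2)
           + (1/(z - of_real c)) * (- 1/2 * y z $ 1 + r12 lam mu gam c * y z $ 2)) (at z)"
    and "((\<lambda>w. y w $ 2) has_field_derivative - (1 / of_real c) * y z $ 1) (at z)"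
proof -
  have d: "((\<lambda>w. y w $ i) has_field_derivative ((coeffM lam mu gam c z *v y z) $ i)) (at z)" for i
    using assms by (auto simp: solves_on_def)
  show "((\<lambda>w. y w $ 1) has_field_derivative
           (1/z) * (- 1/2 * y z $ 1 + a12 lam mu gam c * y z $ 2)
           + (1/(z - 1)) * (- 1/2 * y z $ 1 + b12 lam mu gam c * y z $ 2)
           + (1/(z - of_real c)) * (- 1/2 * y z $ 1 + r12 lam mu gam c * y z $ 2)) (at z)"
  proof (rule DERIV_cong[OF d])
    have "coeffM lam mu gam c z $ 1 $ 1 = 1/z * (- 1/2) + 1/(z - 1) * (- 1/2) + 1/(z - of_real c) * (- 1/2)"
         "coeffM lam mu gam c z $ 1 $ 2 = 1/z * a12 lam mu gam c + 1/(z - 1) * b12 lam mu gam c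
            + 1/(z - of_real c) * r12 lam mu gam c"
      by (simp_all add: coeffM_def msc_def matA_def matB_def matR_def matS_def mult.commute)
    moreover have "(coeffM lam mu gam c z *v y z) $ 1 =
        coeffM lam mu gam c z $ 1 $ 1 * y z $ 1 + coeffM lam mu gam c z $ 1 $ 2 * y z $ 2"
      by (simp add: matrix_vector_mult_def sum_2)
    ultimately show "(coeffM lam mu gam c z *v y z) $ 1 =
        (1/z) * (- 1/2 * y z $ 1 + a12 lam mu gam c * y z $ 2)
           + (1/(z - 1)) * (- 1/2 * y z $ 1 + b12 lam mu gam c * y z $ 2)
           + (1/(z - of_real c)) * (- 1/2 * y z $ 1 + r12 lam mu gam c * y z $ 2)"
      by (simp only: ring_distribs mult_ac add_ac)
  qed
  show "((\<lambda>w. y w $ 2) has_field_derivative - (1 / of_real c) * y z $ 1) (at z)"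
    by (rule DERIV_cong[OF d])
       (simp add: coeffM_def msc_def matA_def matB_def matR_def matS_def matrix_vector_mult_def sum_2)
qed

lemma floquet_sys_at_0:
  assumes "c > 1" and hol: "\<And>i. (\<lambda>z. h z $ i) holomorphic_on ball 0 1"
    and sol: "solves_on lam mu gam c (\<lambda>z. (z powr \<alpha>) *s h z) (ball 0 1 - {z. Im z = 0 \<and> Re z \<le> 0})"
  shows "floquet_sys (a12 lam mu gam c) (b12 lam mu gam c) (r12 lam mu gam c) (of_real c)
            (1 / of_real c) \<alpha> (\<lambda>z. h z $ 1) (\<lambda>z. h z $ 2) (ball 0 1)"
proof (rule floquet_sysI)
  fix z assume z: "z \<in> ball 0 1 - {z. Im z = 0 \<and> Re z \<le> 0}"
  note D = solves_onD[OF sol z, unfolded vector_smult_component]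
  show "((\<lambda>w. w powr \<alpha> * h w $ 1) has_field_derivative
          z powr \<alpha> * ((1/z) * (- 1/2 * h z $ 1 + a12 lam mu gam c * h z $ 2)
            + (1/(z - 1)) * (- 1/2 * h z $ 1 + b12 lam mu gam c * h z $ 2)
            + (1/(z - of_real c)) * (- 1/2 * h z $ 1 + r12 lam mu gam c * h z $ 2))) (at z)"
    by (rule DERIV_cong[OF D(1)]) (simp only: ring_distribs mult_ac)
  show "((\<lambda>w. w powr \<alpha> * h w $ 2) has_field_derivative z powr \<alpha> * (- (1 / of_real c) * h z $ 1)) (at z)"
    by (rule DERIV_cong[OF D(2)]) (simp only: mult_ac)
qed (use assms in auto)

text \<open>The substitution \<open>x = 1 - z\<close> moves 1 to the origin and the cut from 1 to
  infinity onto the negative real axis, so that \<open>floquet_sysI\<close> applies.\<close>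

lemma floquet_sys_at_1:
  assumes c: "c > 1" and r: "0 < r" "r \<le> 1" "r \<le> c - 1"
    and hol: "\<And>i. (\<lambda>z. k z $ i) holomorphic_on ball 1 r"
    and sol: "solves_on lam mu gam c (\<lambda>z. ((1 - z) powr \<beta>) *s k z) (ball 1 r - {z. Im z = 0 \<and> Re z \<ge> 1})"
  shows "floquet_sys (b12 lam mu gam c) (a12 lam mu gam c) (r12 lam mu gam c) (1 - of_real c)
            (- 1 / of_real c) \<beta> (\<lambda>x. k (1 - x) $ 1) (\<lambda>x. k (1 - x) $ 2) (ball 0 r)"
proof (rule floquet_sysI)
  show "(\<lambda>x. k (1 - x) $ 1) holomorphic_on ball 0 r" "(\<lambda>x. k (1 - x) $ 2) holomorphic_on ball 0 r"
    using hol by (auto intro!: holomorphic_on_reflect)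
  have "norm (1 - complex_of_real c) = \<bar>1 - c\<bar>"
    by (metis norm_of_real of_real_1 of_real_diff)
  then show "r \<le> norm (1 - complex_of_real c)" using r c by simp
  fix x assume x: "x \<in> ball 0 r - {z. Im z = 0 \<and> Re z \<le> 0}"
  have z: "1 - x \<in> ball 1 r - {z. Im z = 0 \<and> Re z \<ge> 1}"
    using x by (auto simp: dist_norm)
  note D = solves_onD[OF sol z, unfolded vector_smult_component]
  have m: "((\<lambda>x. 1 - x) has_field_derivative - 1) (at x)"
    by (auto intro!: derivative_eq_intros)
  \<comment> \<open>These signs cancel the \<open>- 1\<close> of the chain rule. The constant term
    of the system has no such sign, hence the change from \<open>s\<close> to
    \<open>- s\<close>.\<close>
  have q: "1 / (1 - x - 1) = - (1 / x)" "1 / (1 - x - of_real c) = - (1 / (x - (1 - of_real c)))"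
    "1 / (1 - x) = - (1 / (x - 1))"
    by (simp_all only: divide_minus_right[symmetric]) (simp_all add: algebra_simps)
  have E: "1 - (1 - x) = x" by simp
  have ch: "((\<lambda>w. w powr \<beta> * k (1 - w) $ i) has_field_derivative d * (- 1)) (at x)"
    if "((\<lambda>w. (1 - w) powr \<beta> * k w $ i) has_field_derivative d) (at (1 - x))" for i d
    using DERIV_chain2[where g = "\<lambda>x. 1 - x" and x = x, OF that m] by simp
  show "((\<lambda>w. w powr \<beta> * k (1 - w) $ 1) has_field_derivative
          x powr \<beta> * ((1/x) * (- 1/2 * k (1 - x) $ 1 + b12 lam mu gam c * k (1 - x) $ 2)
            + (1/(x - 1)) * (- 1/2 * k (1 - x) $ 1 + a12 lam mu gam c * k (1 - x) $ 2)
            + (1/(x - (1 - of_real c))) * (- 1/2 * k (1 - x) $ 1 + r12 lam mu gam c * k (1 - x) $ 2))) (at x)"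
    by (rule DERIV_cong[OF ch[OF D(1)]])
       (simp only: E q ring_distribs mult_ac add_ac mult_minus_left mult_minus_right minus_minus mult_1_left mult_1_right)
  show "((\<lambda>w. w powr \<beta> * k (1 - w) $ 2) has_field_derivative
          x powr \<beta> * (- (- 1 / of_real c) * k (1 - x) $ 1)) (at x)"
    by (rule DERIV_cong[OF ch[OF D(2)]]) (simp add: E)
qed (use r in auto)

text \<open>The relation is given on a real interval only. On the lens of the two discs both
  \<open>z\<close> and \<open>1 - z\<close> have positive real part, so all powers are holomorphic
  there and the identity theorem extends it.\<close>

lemma connection_identity:
  fixes h k1 k2 :: "complex \<Rightarrow> complex"
  assumes h: "h holomorphic_on ball 0 1"
    and k: "k1 holomorphic_on ball 1 r" "k2 holomorphic_on ball 1 r" and r: "0 < r" "r \<le> 1"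
    and conn: "\<And>t::real. 1 - r < t \<Longrightarrow> t < 1 \<Longrightarrow> of_real t powr \<alpha> * h (of_real t) =
        \<Theta> * ((1 - of_real t) powr \<beta>1 * k1 (of_real t)) + \<Omega> * ((1 - of_real t) powr \<beta>2 * k2 (of_real t))"
    and z: "z \<in> ball 0 1 \<inter> ball 1 r"
  shows "(1 - z) powr (- \<beta>1 - 1) * h z = \<Theta> * (z powr (- \<alpha>) * k1 z / (1 - z))
      + \<Omega> * ((1 - z) powr (\<beta>2 - \<beta>1 - 1) * (z powr (- \<alpha>) * k2 z))"
proof -
  let ?U = "ball 0 1 \<inter> ball (1::complex) r"
  define F where "F = (\<lambda>z. (1 - z) powr (- \<beta>1 - 1) * h z - (\<Theta> * (z powr (- \<alpha>) * k1 z / (1 - z))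
      + \<Omega> * ((1 - z) powr (\<beta>2 - \<beta>1 - 1) * (z powr (- \<alpha>) * k2 z))))"
  have Re: "Re w > 0" "Re w < 1" if "w \<in> ?U" for w
  proof -
    show "Re w < 1" using that complex_Re_le_cmod[of w] by auto
    have "Re (1 - w) < 1"
      using that r complex_Re_le_cmod[of "1 - w"] by (auto simp: dist_norm)
    then show "Re w > 0" by simp
  qed
  have inU: "complex_of_real t \<in> ?U" if "1 - r < t" "t < 1" for t
  proof -
    have "norm (1 - complex_of_real t) = \<bar>1 - t\<bar>"
      by (metis norm_of_real of_real_1 of_real_diff)
    then show ?thesis using that r by (simp add: dist_norm)
  qed
  have "F holomorphic_on ?U"
  proof -
    have "(\<lambda>z. (1 - z) powr e) holomorphic_on ?U" for e
      by (rule holomorphic_on_subset[OF holomorphic_on_one_minus_powr[of 1]]) auto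
    moreover have "(\<lambda>z. z powr e) holomorphic_on ?U" for e
    proof (intro holomorphic_intros)
      show "z \<notin> \<real>\<^sub>\<le>\<^sub>0" if "z \<in> ?U" for z using Re(1)[OF that] by (auto simp: complex_nonpos_Reals_iff)
    qed
    moreover have "h holomorphic_on ?U" "k1 holomorphic_on ?U" "k2 holomorphic_on ?U"
      using h k by (auto intro: holomorphic_on_subset)
    moreover have "1 - w \<noteq> 0" if "w \<in> ?U" for w using Re[OF that] by auto
    ultimately show ?thesis
      unfolding F_def
      by (intro holomorphic_on_add holomorphic_on_diff holomorphic_on_mult holomorphic_on_divide
          holomorphic_on_const holomorphic_on_ident) auto
  qed
  moreover have "open ?U" "connected ?U"
    by (auto intro!: convex_connected convex_Int)
  moreover have "complex_of_real ` {1 - r<..<1} \<subseteq> ?U"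
    using inU by auto
  moreover have "complex_of_real (1 - r/2) \<in> ?U"
    using r by (intro inU) auto
  moreover have "complex_of_real (1 - r/2) islimpt complex_of_real ` {1 - r<..<1}"
    unfolding islimpt_approachable
  proof (intro allI impI)
    fix e :: real assume e: "e > 0"
    \<comment> \<open>A step to the right of at most \<open>r/4\<close>, so \<open>t\<close> stays
      below 1, differs from the midpoint and lies within \<open>e\<close> of it.\<close>
    define t where "t = 1 - r/2 + min e (r/2) / 2"
    have t: "1 - r < t" "t < 1" "t \<noteq> 1 - r/2" "\<bar>t - (1 - r/2)\<bar> < e"
      using e r by (auto simp: t_def min_def)
    then show "\<exists>x'\<in>complex_of_real ` {1 - r<..<1}. x' \<noteq> complex_of_real (1 - r/2) \<and>
        dist x' (complex_of_real (1 - r/2)) < e"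
      by (intro bexI[of _ "of_real t"]) (auto simp: dist_of_real simp del: of_real_diff, auto simp: dist_real_def)
  qed
  moreover have "F w = 0" if w: "w \<in> complex_of_real ` {1 - r<..<1}" for w
  proof -
    obtain t where t: "w = of_real t" "1 - r < t" "t < 1" using w by auto
    have nz: "w \<noteq> 0" "1 - w \<noteq> 0" using t r by auto
    have "h w = w powr (- \<alpha>) * (w powr \<alpha> * h w)"
      using nz by (simp add: powr_minus)
    also have "w powr \<alpha> * h w = \<Theta> * ((1 - w) powr \<beta>1 * k1 w) + \<Omega> * ((1 - w) powr \<beta>2 * k2 w)"
      using conn t by simp
    finally have hw: "h w = w powr (- \<alpha>) * \<dots>" .
    have p1: "(1 - w) powr (- \<beta>1 - 1) * (1 - w) powr \<beta>1 = 1 / (1 - w)"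
      using nz by (simp add: powr_diff powr_minus field_simps)
    have p2: "(1 - w) powr (- \<beta>1 - 1) * (1 - w) powr \<beta>2 = (1 - w) powr (\<beta>2 - \<beta>1 - 1)"
      unfolding powr_add[symmetric] by (simp add: algebra_simps)
    have "(1 - w) powr (- \<beta>1 - 1) * h w =
        \<Theta> * (w powr (- \<alpha>) * k1 w * ((1 - w) powr (- \<beta>1 - 1) * (1 - w) powr \<beta>1))
        + \<Omega> * (((1 - w) powr (- \<beta>1 - 1) * (1 - w) powr \<beta>2) * (w powr (- \<alpha>) * k2 w))"
      unfolding hw by (simp only: ring_distribs mult_ac)
    then show ?thesis
      unfolding F_def p1 p2 by simp
  qed
  ultimately have "F z = 0"
    using z by (rule analytic_continuation)
  then show ?thesis by (simp add: F_def)
qed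

text \<open>An integer number of derivatives misses the half-integer error exponent, so the
  expansion is taken several terms too far. The surplus terms with \<open>l > n\<close> are then
  estimated by their own asymptotics, and dividing the others by \<open>w 0\<close> produces the
  products of \<open>pvec\<close>.\<close>

lemma expansion_error_bigo:
  fixes D d :: "nat \<Rightarrow> complex" and \<sigma> n :: nat and \<Theta> \<Omega> b :: complex
  defines "w \<equiv> \<lambda>l k. taylor_coeff (\<lambda>z. (1 - z) powr (of_real (1/2 - real \<sigma> - 1 + real l))) k"
  assumes sigma: "\<sigma> \<in> {0, 1}"
    and bd: "\<And>N m. real m \<le> (1/2 - real \<sigma>) + real N \<Longrightarrow>
       \<exists>K. \<forall>k. norm (D k - \<Theta> * b - \<Omega> * (\<Sum>l\<le>N. d l * w l k)) * real (Suc k) ^ m \<le> K"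
  shows "(\<lambda>k. D k - \<Theta> * b - \<Omega> * w 0 k * (d 0 +
      (\<Sum>l=1..n. (\<Prod>m=0..<l. (of_nat m + 1/2 - of_nat \<sigma>) / (of_nat m + 1/2 - of_nat \<sigma> - of_nat k)) * d l)))
      \<in> O(\<lambda>k. of_real (real k powr (real \<sigma> - real n - 3/2)))"
proof -
  let ?q = "real \<sigma> - real n - 3/2"
  \<comment> \<open>Large enough to allow \<open>m = n + 2\<close> for both values of
    \<open>\<sigma>\<close>, and \<open>n + 2 + ?q = \<sigma> + 1/2\<close> is positive, so
    \<open>R\<close> decays faster than required.\<close>
  let ?N = "n + 3"
  define c where "c = (\<lambda>l k. \<Prod>m=0..<l. (of_nat m + 1/2 - of_nat \<sigma>) / (of_nat m + 1/2 - of_nat \<sigma> - of_nat k :: complex))"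
  define R where "R = (\<lambda>k. D k - \<Theta> * b - \<Omega> * (\<Sum>l\<le>?N. d l * w l k))"
  have "real (n + 2) \<le> (1/2 - real \<sigma>) + real ?N" using sigma by auto
  from bd[OF this] obtain K where K: "\<And>k. norm (R k) * real (Suc k) ^ (n + 2) \<le> K"
    unfolding R_def by blast
  have R: "R \<in> O(\<lambda>k. of_real (real k powr ?q))"
  proof (rule bigoI[of _ K], rule eventually_mono[OF eventually_gt_at_top[of "0::nat"]])
    fix k :: nat assume k: "k > 0"
    have "1 \<le> real k powr (real (n + 2) + ?q)"
      using k sigma by (intro ge_one_powr_ge_zero) auto
    also have "\<dots> = real k ^ (n + 2) * real k powr ?q"
      using k by (subst powr_add, subst powr_realpow) auto
    also have "\<dots> \<le> real (Suc k) ^ (n + 2) * real k powr ?q"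
      by (intro mult_right_mono power_mono) auto
    finally have "norm (R k) * 1 \<le> norm (R k) * (real (Suc k) ^ (n + 2) * real k powr ?q)"
      by (intro mult_left_mono) auto
    also have "\<dots> = (norm (R k) * real (Suc k) ^ (n + 2)) * real k powr ?q"
      by simp
    also have "\<dots> \<le> K * real k powr ?q"
      by (intro mult_right_mono K) auto
    finally show "norm (R k) \<le> K * norm (complex_of_real (real k powr ?q))" by simp
  qed
  have wO: "(\<lambda>k. d l * w l k) \<in> O(\<lambda>k. of_real (real k powr ?q))" if l: "l > n" for l
  proof -
    have "w l \<in> O(\<lambda>k. of_real (real k powr (- (1/2 - real \<sigma> - 1 + real l) - 1)))"
      unfolding w_def by (rule taylor_coeff_one_minus_powr_bigo)
    also have "(\<lambda>k. complex_of_real (real k powr (- (1/2 - real \<sigma> - 1 + real l) - 1)))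
        \<in> O(\<lambda>k. of_real (real k powr ?q))"
    proof (rule bigoI[of _ 1], rule eventually_mono[OF eventually_gt_at_top[of "0::nat"]])
      fix k :: nat assume k: "k > 0"
      have "real k powr (- (1/2 - real \<sigma> - 1 + real l) - 1) \<le> real k powr ?q"
        using k l by (intro powr_mono) auto
      then show "norm (complex_of_real (real k powr (- (1/2 - real \<sigma> - 1 + real l) - 1)))
          \<le> 1 * norm (complex_of_real (real k powr ?q))" by simp
    qed
    finally show ?thesis by (cases "d l = 0") simp_all
  qed
  have wc: "w l k = c l k * w 0 k" for l k
  proof (induction l)
    case 0
    then show ?case by (simp add: c_def)
  next
    case (Suc l)
    let ?e = "complex_of_real (1/2 - real \<sigma> - 1 + real l)"
    have e1: "?e + 1 = of_nat l + 1/2 - of_nat \<sigma>" by simp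
    \<comment> \<open>Parity: the left side is half of an odd integer, so no denominator
      vanishes.\<close>
    have "?e + 1 \<noteq> of_nat k"
    proof
      assume "?e + 1 = of_nat k"
      moreover have "complex_of_real (1/2 - real \<sigma> + real l) = ?e + 1" by simp
      ultimately have "complex_of_real (1/2 - real \<sigma> + real l) = of_real (real k)" by simp
      then have "1/2 - real \<sigma> + real l = real k" by (rule of_real_eq_iff[THEN iffD1])
      then have "1 + 2 * real l = 2 * real k + 2 * real \<sigma>" by simp
      then have "real (1 + 2 * l) = real (2 * k + 2 * \<sigma>)" by simp
      then have "1 + 2 * l = 2 * k + 2 * \<sigma>" by (rule of_nat_eq_iff[THEN iffD1])
      then show False by presburger
    qed
    from taylor_coeff_one_minus_powr_step[OF this]
    have "taylor_coeff (\<lambda>z. (1 - z) powr (?e + 1)) k = (?e + 1) / (?e + 1 - of_nat k) * w l k"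
      by (simp add: w_def)
    moreover have "complex_of_real (1/2 - real \<sigma> - 1 + real (Suc l)) = ?e + 1" by simp
    ultimately have "w (Suc l) k = (?e + 1) / (?e + 1 - of_nat k) * w l k"
      unfolding w_def by simp
    then show ?case
      unfolding Suc.IH e1 by (simp add: c_def)
  qed
  have "(\<Sum>l\<le>?N. d l * w l k) = (\<Sum>l\<le>n. d l * w l k) + (\<Sum>l=Suc n..?N. d l * w l k)" for k
  proof -
    have "{..?N} = {..n} \<union> {Suc n..?N}" by auto
    then show ?thesis by (simp only:) (rule sum.union_disjoint, auto)
  qed
  moreover have "(\<Sum>l\<le>n. d l * w l k) = w 0 k * (d 0 + (\<Sum>l=1..n. c l k * d l))" for k
  proof -
    have "(\<Sum>l\<le>n. d l * w l k) = w 0 k * (\<Sum>l\<le>n. c l k * d l)"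
      unfolding sum_distrib_left
    proof (rule sum.cong[OF refl])
      fix l
      show "d l * w l k = w 0 k * (c l k * d l)"
        by (subst wc) (simp only: mult_ac)
    qed
    also have "(\<Sum>l\<le>n. c l k * d l) = d 0 + (\<Sum>l=1..n. c l k * d l)"
      by (simp add: atMost_atLeast0 sum.atLeast_Suc_atMost c_def)
    finally show ?thesis .
  qed
  ultimately have "D k - \<Theta> * b - \<Omega> * w 0 k * (d 0 + (\<Sum>l=1..n. c l k * d l)) =
      R k + \<Omega> * (\<Sum>l=Suc n..?N. d l * w l k)" for k
    by (simp add: R_def algebra_simps)
  moreover have "(\<lambda>k. R k + \<Omega> * (\<Sum>l=Suc n..?N. d l * w l k)) \<in> O(\<lambda>k. of_real (real k powr ?q))"
  proof (intro sum_in_bigo R)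
    have "(\<lambda>k. \<Sum>l=Suc n..?N. d l * w l k) \<in> O(\<lambda>k. of_real (real k powr ?q))"
      by (intro big_sum_in_bigo wO) auto
    then show "(\<lambda>k. \<Omega> * (\<Sum>l=Suc n..?N. d l * w l k)) \<in> O(\<lambda>k. of_real (real k powr ?q))"
      by (cases "\<Omega> = 0") simp_all
  qed
  ultimately show ?thesis
    by (simp add: c_def)
qed

text \<open>Every product in the sum has at least one factor, and each factor has \<open>k\<close>
  in its denominator.\<close>

lemma pvec_tendsto: "(\<lambda>k. pvec lam mu gam c \<rho> \<sigma> n k $ i) \<longlonglongrightarrow> vec_b2 lam mu gam c \<sigma> $ i"
proof -
  have z: "(\<lambda>k. \<Prod>m=0..<l. a m / (a m - of_nat k)) \<longlonglongrightarrow> 0" if "l \<ge> 1" for l and a :: "nat \<Rightarrow> complex"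
  proof -
    have "(\<lambda>k. a m / (a m - of_nat k)) \<longlonglongrightarrow> 0" for m
    proof -
      have "(\<lambda>k. - a m / (of_nat k + - a m)) \<longlonglongrightarrow> 0"
        by (intro tendsto_divide_0[OF tendsto_const]
            tendsto_add_filterlim_at_infinity'[OF tendsto_of_nat tendsto_const])
      moreover have "- a m / (of_nat k + - a m) = a m / (a m - of_nat k)" for k
        using minus_divide_divide[of "a m" "a m - of_nat k"] by simp
      ultimately show ?thesis by simp
    qed
    then have "(\<lambda>k. \<Prod>m=0..<l. a m / (a m - of_nat k)) \<longlonglongrightarrow> (\<Prod>m=0..<l. 0)"
      by (intro tendsto_prod)
    then show ?thesis using that by (simp add: power_0_left)
  qed
  have "(\<lambda>k. vec_b2 lam mu gam c \<sigma> $ i + (\<Sum>l=1..n. (\<Prod>m=0..<l. (of_nat m + 1/2 - of_nat \<sigma>)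
        / (of_nat m + 1/2 - of_nat \<sigma> - of_nat k)) * dseq_t lam mu gam c \<rho> \<sigma> l $ i))
      \<longlonglongrightarrow> vec_b2 lam mu gam c \<sigma> $ i + (\<Sum>l=1..n. 0 * dseq_t lam mu gam c \<rho> \<sigma> l $ i)"
    by (intro tendsto_intros z) auto
  then show ?thesis
    by (simp add: pvec_def)
qed

text \<open>The pairing is the determinant with columns \<open>x\<close> and \<open>y\<close>, hence
  zero on parallel vectors.\<close>

lemma bil_matJ: "bil x (matJ *v y) = x $ 1 * y $ 2 - x $ 2 * y $ 1"
  by (simp add: bil_def matJ_def mat2_mult_nth)

text \<open>The determinant is 1/2 for \<open>\<sigma> = 0\<close> and -1/2 for
  \<open>\<sigma> = 1\<close>, whatever the value of \<open>b12\<close>.\<close>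

lemma wronskian_b1_b2_neq_0:
  assumes "\<sigma> \<in> {0, 1}"
  shows "bil (vec_b1 lam mu gam c \<sigma>) (matJ *v vec_b2 lam mu gam c \<sigma>) \<noteq> 0"
  using assms by (auto simp: bil_matJ vec_b1_def vec_b2_def)

text \<open>As \<open>1/2 - \<sigma>\<close> is never an integer, the fundamental matrix at 1 has no
  logarithm, so \<open>y1\<close> and \<open>y2\<close> are pure powers times the columns of
  \<open>H\<close>. The radius \<open>r1\<close> is the distance from 1 to the nearer of 0 and
  \<open>c\<close>; the connection relation is imposed on the real points left of 1, where all
  branches are principal.\<close>

theorem theorem5:
  fixes lam mu gam :: complex and c :: real and \<rho> \<sigma> n :: nat
    and h0 :: "complex \<Rightarrow> complex^2" and H :: "complex \<Rightarrow> complex^2^2"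
    and \<Theta> \<Omega> :: complex
  defines "r1 \<equiv> min 1 (c - 1)"
  defines "y0 \<equiv> (\<lambda>z. (z powr (of_real (- real \<rho> / 2))) *s h0 z)"
  defines "y1 \<equiv> (\<lambda>z. ((1 - z) powr (of_real ((real \<sigma> - 1) / 2))) *s (H z *v axis 1 1))"
  defines "y2 \<equiv> (\<lambda>z. ((1 - z) powr (of_real (- real \<sigma> / 2))) *s (H z *v axis 2 1))"
  assumes c: "c > 1"
    and rho: "\<rho> \<in> {0, 1}" and sigma: "\<sigma> \<in> {0, 1}"
    and h0_hol: "\<forall>i. (\<lambda>z. h0 z $ i) holomorphic_on ball 0 1"
    and h0_0: "h0 0 = vec_a0 lam mu gam c \<rho>"
    and y0_sol: "solves_on lam mu gam c y0 (ball 0 1 - {z. Im z = 0 \<and> Re z \<le> 0})"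
    and H_hol: "\<forall>i j. (\<lambda>z. H z $ i $ j) holomorphic_on ball 1 r1"
    and H_1: "H 1 *v axis 1 1 = vec_b1 lam mu gam c \<sigma>" "H 1 *v axis 2 1 = vec_b2 lam mu gam c \<sigma>"
    and y1_sol: "solves_on lam mu gam c y1 (ball 1 r1 - {z. Im z = 0 \<and> Re z \<ge> 1})"
    and y2_sol: "solves_on lam mu gam c y2 (ball 1 r1 - {z. Im z = 0 \<and> Re z \<ge> 1})"
    and conn: "\<forall>t::real. 1 - r1 < t \<and> t < 1 \<longrightarrow>
                 y0 (of_real t) = \<Theta> *s y1 (of_real t) + \<Omega> *s y2 (of_real t)"
  shows "eventually (\<lambda>k. bil (vec_b1 lam mu gam c \<sigma>) (matJ *v pvec lam mu gam c \<rho> \<sigma> n k) \<noteq> 0) sequentially \<and>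
         ((\<lambda>k. Theta_k lam mu gam c \<rho> \<sigma> n k) \<longlonglongrightarrow> \<Theta>) \<and>
         ((\<lambda>k. norm (Theta_k lam mu gam c \<rho> \<sigma> n k - \<Theta>))
           \<in> O(\<lambda>k. real k powr (real \<sigma> - real n - 3/2)))"
proof -
  have r1: "0 < r1" "r1 \<le> 1" "r1 \<le> c - 1" using c by (auto simp: r1_def)
  define \<alpha> :: complex where "\<alpha> = - of_nat \<rho> / 2"
  define \<beta>1 :: complex where "\<beta>1 = (of_nat \<sigma> - 1) / 2"
  define \<beta>2 :: complex where "\<beta>2 = - of_nat \<sigma> / 2"
  define k1 where "k1 z = H z *v axis 1 1" for z
  define k2 where "k2 z = H z *v axis 2 1" for z
  have exps: "complex_of_real (- real \<rho> / 2) = \<alpha>" "complex_of_real ((real \<sigma> - 1) / 2) = \<beta>1"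
    "complex_of_real (- real \<sigma> / 2) = \<beta>2"
    by (simp_all add: \<alpha>_def \<beta>1_def \<beta>2_def)
  note y_defs = y0_def[unfolded exps] y1_def[unfolded exps, folded k1_def] y2_def[unfolded exps, folded k2_def]
  have k_nth: "k1 z $ i = H z $ i $ 1" "k2 z $ i = H z $ i $ 2" for z i
    by (simp_all add: k1_def k2_def matrix_vector_mult_def sum_2 axis_def)
  have h0: "(\<lambda>z. h0 z $ i) holomorphic_on ball 0 1" for i using h0_hol by simp
  have k: "(\<lambda>z. k1 z $ i) holomorphic_on ball 1 r1" "(\<lambda>z. k2 z $ i) holomorphic_on ball 1 r1" for i
    using H_hol by (simp_all add: k_nth)
  have sys0: "floquet_sys (a12 lam mu gam c) (b12 lam mu gam c) (r12 lam mu gam c) (of_real c)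
            (1 / of_real c) \<alpha> (\<lambda>z. h0 z $ 1) (\<lambda>z. h0 z $ 2) (ball 0 1)"
    using floquet_sys_at_0[OF c h0 y0_sol[unfolded y_defs]] .
  have sys1: "floquet_sys (b12 lam mu gam c) (a12 lam mu gam c) (r12 lam mu gam c) (1 - of_real c)
            (- 1 / of_real c) \<beta>2 (\<lambda>x. k2 (1 - x) $ 1) (\<lambda>x. k2 (1 - x) $ 2) (ball 0 r1)"
    using floquet_sys_at_1[OF c r1 k(2) y2_sol[unfolded y_defs]] .
  \<comment> \<open>The exponent turns the \<open>\<Theta>\<close>-term into a simple pole at 1,
    whose coefficients are constant in \<open>k\<close>, and leaves \<open>\<delta> - 1\<close> on
    the \<open>\<Omega>\<close>-term.\<close>
  define f where "f = (\<lambda>i z. (1 - z) powr (- \<beta>1 - 1) * h0 z $ i)"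
  define G1 G2 where "G1 = (\<lambda>i z. z powr (- \<alpha>) * k1 z $ i)" and "G2 = (\<lambda>i z. z powr (- \<alpha>) * k2 z $ i)"

  have dseq: "dseq lam mu gam c \<rho> \<sigma> m = vec2 (taylor_coeff (f 1) m) (taylor_coeff (f 2) m)" for m
    unfolding f_def
    by (rule dseq_eq_taylor_coeff[OF h0 h0 _ _ _ rho sys0[unfolded \<alpha>_def] _ \<beta>1_def])
       (use c h0_0 in \<open>auto simp: vec2_eq_iff\<close>)
  have dseq_t: "dseq_t lam mu gam c \<rho> \<sigma> m =
      vec2 (taylor_coeff (\<lambda>x. G2 1 (1 - x)) m) (taylor_coeff (\<lambda>x. G2 2 (1 - x)) m)" for m
  proof -
    have hol: "(\<lambda>x. k2 (1 - x) $ i) holomorphic_on ball 0 r1" for i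
      using holomorphic_on_reflect[of "\<lambda>z. k2 z $ i" 0 r1] k(2) by simp
    have "vec_b2 lam mu gam c \<sigma> = vec2 (k2 (1 - 0) $ 1) (k2 (1 - 0) $ 2)"
      using H_1(2) by (simp add: vec2_eq_iff k2_def)
    from dseq_t_eq_taylor_coeff[OF hol hol r1 sigma sys1[unfolded \<beta>2_def] this refl, of \<rho> m]
    show ?thesis
      by (simp add: G2_def \<alpha>_def)
  qed

  have f_hol: "f i holomorphic_on ball 0 1" for i
    unfolding f_def by (intro holomorphic_on_mult holomorphic_on_one_minus_powr h0) auto
  have G_hol: "G1 i holomorphic_on ball 1 r1" "G2 i holomorphic_on ball 1 r1" for i
  proof -
    have "(\<lambda>z. z powr (- \<alpha>)) holomorphic_on ball 1 r1"
    proof (intro holomorphic_intros)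
      fix z :: complex assume "z \<in> ball 1 r1"
      then have "Re (1 - z) < 1"
        using r1 complex_Re_le_cmod[of "1 - z"] by (auto simp: dist_norm)
      then show "z \<notin> \<real>\<^sub>\<le>\<^sub>0" by (auto simp: complex_nonpos_Reals_iff)
    qed
    then show "G1 i holomorphic_on ball 1 r1" "G2 i holomorphic_on ball 1 r1"
      unfolding G1_def G2_def by (auto intro!: holomorphic_on_mult k)
  qed
  have near: "f i z = \<Theta> * (G1 i z / (1 - z)) + \<Omega> * ((1 - z) powr (of_real (1/2 - real \<sigma>) - 1) * G2 i z)"
    if "z \<in> ball 0 1 \<inter> ball 1 r1" for i z
  proof -
    have "of_real t powr \<alpha> * h0 (of_real t) $ i =
        \<Theta> * ((1 - of_real t) powr \<beta>1 * k1 (of_real t) $ i) + \<Omega> * ((1 - of_real t) powr \<beta>2 * k2 (of_real t) $ i)"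
      if "1 - r1 < t" "t < 1" for t :: real
    proof -
      have "y0 (of_real t) $ i = (\<Theta> *s y1 (of_real t) + \<Omega> *s y2 (of_real t)) $ i"
        using conn that by simp
      then show ?thesis by (simp add: y_defs)
    qed
    from connection_identity[OF h0 k r1(1,2) this that]
    have "f i z = \<Theta> * (G1 i z / (1 - z)) + \<Omega> * ((1 - z) powr (\<beta>2 - \<beta>1 - 1) * G2 i z)"
      by (simp add: f_def G1_def G2_def)
    moreover have "\<beta>2 - \<beta>1 - 1 = of_real (1/2 - real \<sigma>) - 1"
      by (simp add: \<beta>1_def \<beta>2_def field_simps)
    ultimately show ?thesis by simp
  qed
  have c1: "norm (complex_of_real c) > 1" using c by simp
  obtain n11 n12 n21 n22 where lin:
    "n11 holomorphic_on - {0, 1, of_real c}" "n12 holomorphic_on - {0, 1, of_real c}"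
    "n21 holomorphic_on - {0, 1, of_real c}" "n22 holomorphic_on - {0, 1, of_real c}"
    "\<And>z. z \<in> ball 0 1 - {0} \<Longrightarrow> deriv (\<lambda>z. h0 z $ 1) z = n11 z * h0 z $ 1 + n12 z * h0 z $ 2"
    "\<And>z. z \<in> ball 0 1 - {0} \<Longrightarrow> deriv (\<lambda>z. h0 z $ 2) z = n21 z * h0 z $ 1 + n22 z * h0 z $ 2"
    by (rule floquet_sys_imp_linear[OF sys0 c1]) auto
  have away: "\<exists>C. \<forall>z\<in>ball 0 1. \<epsilon> \<le> norm (1 - z) \<longrightarrow> norm ((deriv ^^ m) (f i) z) \<le> C"
    if "\<epsilon> > 0" "i \<in> {1, 2}" for m i \<epsilon>
    unfolding f_def
    by (rule higher_deriv_bounded_away[OF h0 h0 lin c1 that(1)]) (use that in auto)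

  define w0 where "w0 = (\<lambda>k. taylor_coeff (\<lambda>z. (1 - z) powr (of_real (1/2 - real \<sigma> - 1 + real 0))) k)"
  let ?p = "\<lambda>k. pvec lam mu gam c \<rho> \<sigma> n k"
  let ?b1 = "vec_b1 lam mu gam c \<sigma>"
  let ?O = "O(\<lambda>k. complex_of_real (real k powr (real \<sigma> - real n - 3/2)))"
  \<comment> \<open>Both components are corrected by the same scalar \<open>\<Omega> * w0 k\<close>
    times \<open>pvec\<close>; this common direction is what the pairing removes.\<close>
  define err where "err = (\<lambda>i k. taylor_coeff (f i) k - \<Theta> * ?b1 $ i - \<Omega> * w0 k * ?p k $ i)"
  have err: "err i \<in> ?O" if i: "i \<in> {1, 2}" for i
  proof -
    have G11: "G1 i 1 = ?b1 $ i" using H_1(1) by (simp add: G1_def k1_def)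
    have b2: "vec_b2 lam mu gam c \<sigma> $ i = taylor_coeff (\<lambda>x. G2 i (1 - x)) 0"
      using H_1(2) by (simp add: G2_def k2_def taylor_coeff_def)
    have dt: "dseq_t lam mu gam c \<rho> \<sigma> l $ i = taylor_coeff (\<lambda>x. G2 i (1 - x)) l" for l
      using i by (auto simp: dseq_t)
    have "(\<lambda>k. taylor_coeff (f i) k - \<Theta> * G1 i 1 - \<Omega> * w0 k * (taylor_coeff (\<lambda>x. G2 i (1 - x)) 0 +
      (\<Sum>l=1..n. (\<Prod>m=0..<l. (of_nat m + 1/2 - of_nat \<sigma>) / (of_nat m + 1/2 - of_nat \<sigma> - of_nat k))
         * taylor_coeff (\<lambda>x. G2 i (1 - x)) l))) \<in> ?O"
      unfolding w0_def
    proof (rule expansion_error_bigo[OF sigma])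
      fix N m :: nat assume "real m \<le> 1/2 - real \<sigma> + real N"
      from darboux_expansion[OF f_hol G_hol r1(1) near away[OF _ i] this]
      show "\<exists>K. \<forall>k. norm (taylor_coeff (f i) k - \<Theta> * G1 i 1 - \<Omega> * (\<Sum>l\<le>N. taylor_coeff (\<lambda>x. G2 i (1 - x)) l *
          taylor_coeff (\<lambda>z. (1 - z) powr complex_of_real (1 / 2 - real \<sigma> - 1 + real l)) k)) * real (Suc k) ^ m \<le> K"
        by simp
    qed
    then show ?thesis
      by (simp add: err_def pvec_def b2 dt G11)
  qed

  define den where "den = (\<lambda>k. bil ?b1 (matJ *v ?p k))"
  have den_lim: "den \<longlonglongrightarrow> bil ?b1 (matJ *v vec_b2 lam mu gam c \<sigma>)"
    unfolding den_def bil_matJ by (intro tendsto_intros pvec_tendsto)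
  note W = wronskian_b1_b2_neq_0[OF sigma, of lam mu gam c]
  have den_nz: "eventually (\<lambda>k. den k \<noteq> 0) sequentially"
    by (rule tendsto_imp_eventually_ne[OF den_lim W])
  \<comment> \<open>In the determinant of \<open>dseq\<close> with \<open>pvec\<close> the
    \<open>\<Omega>\<close> contributions cancel and the \<open>\<Theta>\<close> contributions sum
    to \<open>\<Theta> * den k\<close>, so only the errors survive.\<close>
  have ev: "eventually (\<lambda>k. err 1 k * (?p k $ 2 / den k) - err 2 k * (?p k $ 1 / den k)
      = Theta_k lam mu gam c \<rho> \<sigma> n k - \<Theta>) sequentially"
    using den_nz
  proof eventually_elim
    case (elim k)
    let ?P1 = "?p k $ 1" and ?P2 = "?p k $ 2"
    let ?d1 = "taylor_coeff (f 1) k" and ?d2 = "taylor_coeff (f 2) k"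
    have den_k: "den k = ?b1 $ 1 * ?P2 - ?b1 $ 2 * ?P1" by (simp add: den_def bil_matJ)
    have "Theta_k lam mu gam c \<rho> \<sigma> n k = (?d1 * ?P2 - ?d2 * ?P1) / den k"
      unfolding Theta_k_def varth_def den_def[symmetric] dseq
      by (simp add: den_k bil_def matJ_def mat2_mult_nth diff_divide_distrib)
    also have "?d1 = err 1 k + \<Theta> * ?b1 $ 1 + \<Omega> * w0 k * ?P1" by (simp add: err_def)
    also have "?d2 = err 2 k + \<Theta> * ?b1 $ 2 + \<Omega> * w0 k * ?P2" by (simp add: err_def)
    also have "(err 1 k + \<Theta> * ?b1 $ 1 + \<Omega> * w0 k * ?P1) * ?P2 - (err 2 k + \<Theta> * ?b1 $ 2 + \<Omega> * w0 k * ?P2) * ?P1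
        = err 1 k * ?P2 - err 2 k * ?P1 + \<Theta> * den k"
      unfolding den_k by (simp add: algebra_simps)
    also have "\<dots> / den k = err 1 k * (?P2 / den k) - err 2 k * (?P1 / den k) + \<Theta>"
      using elim by (simp add: add_divide_distrib diff_divide_distrib)
    finally show ?case by simp
  qed
  have errO: "(\<lambda>k. err 1 k * (?p k $ 2 / den k) - err 2 k * (?p k $ 1 / den k)) \<in> ?O"
  proof -
    \<comment> \<open>Numerator and denominator converge and the limit of \<open>den\<close> is
      nonzero, so the weights on the errors are bounded.\<close>
    have q: "(\<lambda>k. ?p k $ i / den k) \<in> O(\<lambda>_. 1)" for i
    proof (rule bigoI_tendsto)
      show "(\<lambda>k. ?p k $ i / den k / 1) \<longlonglongrightarrow>
          vec_b2 lam mu gam c \<sigma> $ i / bil ?b1 (matJ *v vec_b2 lam mu gam c \<sigma>) / 1"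
        by (intro tendsto_intros pvec_tendsto den_lim W) auto
    qed simp
    have "(\<lambda>k. err j k * (?p k $ i / den k)) \<in> ?O" if "j \<in> {1, 2}" for i j
      using landau_o.big.mult[OF err[OF that] q[of i]] by simp
    then show ?thesis by (intro sum_in_bigo) auto
  qed
  have "(\<lambda>k. Theta_k lam mu gam c \<rho> \<sigma> n k - \<Theta>) \<in> ?O"
    using errO unfolding landau_o.big.in_cong[OF ev] .
  then have O: "(\<lambda>k. norm (Theta_k lam mu gam c \<rho> \<sigma> n k - \<Theta>))
           \<in> O(\<lambda>k. real k powr (real \<sigma> - real n - 3/2))"
    unfolding bigo_of_real_iff .
  then obtain C where C: "eventually (\<lambda>k. norm (norm (Theta_k lam mu gam c \<rho> \<sigma> n k - \<Theta>)) \<le>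
      C * norm (real k powr (real \<sigma> - real n - 3/2))) sequentially"
    by (elim landau_o.bigE)
  \<comment> \<open>The exponent is at most -1/2, so the error estimate implies convergence for
    every \<open>n\<close>, including 0.\<close>
  have "(\<lambda>k. real k powr (real \<sigma> - real n - 3/2)) \<longlonglongrightarrow> 0"
    using sigma by (intro tendsto_neg_powr filterlim_real_sequentially) auto
  from tendsto_mult_left[OF this, of C]
  have "(\<lambda>k. C * real k powr (real \<sigma> - real n - 3/2)) \<longlonglongrightarrow> 0" by simp
  then have "(\<lambda>k. Theta_k lam mu gam c \<rho> \<sigma> n k - \<Theta>) \<longlonglongrightarrow> 0"
    by (rule Lim_null_comparison[rotated]) (use C in simp)
  then have "(\<lambda>k. Theta_k lam mu gam c \<rho> \<sigma> n k) \<longlonglongrightarrow> \<Theta>"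
    by (rule LIM_zero_cancel)
  then show ?thesis
    using den_nz O by (simp add: den_def)
qed

end
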